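(* Let $\mathbb{G}$ be a homogeneous group of homogeneous dimension $Q$ with a homogeneous quasi-norm $|\cdot|$. Let $\phi_1,\phi_2,\psi_1,\psi_2$ be positive functions on $\mathbb{G}$, let $1<p\le q<\infty$ and $1/p+1/p'=1$. Then the inequality $$\left(\int_{\mathbb{G}}\left(\int_{B(0,|x|)}f(z)\,dz\right)^{q}\phi_{1}(x)\,dx\right)^{1/q}\le C_{1}\left(\int_{\mathbb{G}}(f(x))^{p}\psi_{1}(x)\,dx\right)^{1/p}$$ holds (for some finite constant $C_1$) for all $f\ge 0$ a.e. on $\mathbb{G}$ if and only if $$A_{1}:=\sup_{R>0}\left(\int_{\{|x|\ge R\}}\phi_{1}(x)\,dx\right)^{1/q}\left(\int_{\{|x|\le R\}}(\psi_{1}(x))^{-(p'-1)}dx\right)^{1/p'}<\infty,$$ and the inequality $$\left(\int_{\mathbb{G}}\left(\int_{\mathbb{G}\setminus B(0,|x|)}f(z)\,dz\right)^{q}\phi_{2}(x)\,dx\right)^{1/q}\le C_{2}\left(\int_{\mathbb{G}}(f(x))^{p}\psi_{2}(x)\,dx\right)^{1/p}$$ holds (for some finite constant $C_2$) for all $f\ge 0$ a.e. on $\mathbb{G}$ if and only if $$A_{2}:=\sup_{R>0}\left(\int_{\{|x|\le R\}}\phi_{2}(x)\,dx\right)^{1/q}\left(\int_{\{|x|\ge R\}}(\psi_{2}(x))^{-(p'-1)}dx\right)^{1/p'}<\infty.$$ Moreover, if $C_1$, $C_2$ are the smallest constants for which these two inequalities hold, then $$A_{i}\le C_{i}\le (p')^{1/p'}p^{1/q}A_{i},\qquad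 i=1,2.$$
   Context: A homogeneous group $\mathbb{G}$ is a connected simply connected Lie group whose Lie algebra $\mathfrak g$ is equipped with a family of dilations $D_\lambda=\mathrm{Exp}(A\ln\lambda)$, $\lambda>0$, where $A$ is a diagonalisable linear operator on $\mathfrak g$ with positive eigenvalues and each $D_\lambda$ is a Lie algebra morphism. Through the exponential map, $\mathbb G$ is identified with $\mathbb R^n$ (identity element $0$), the dilations act on $\mathbb G$ (written $x\mapsto\lambda x$), and Lebesgue measure $dx$ is a Haar measure. The homogeneous dimension is $Q=\mathrm{Tr}\,A$. A homogeneous quasi-norm is a continuous function $|\cdot|:\mathbb G\to[0,\infty)$ with $|x^{-1}|=|x|$, $|\lambda x|=\lambda|x|$ for $\lambda>0$, and $|x|=0$ iff $x=0$. Quasi-balls: $B(x,R)=\{y\in\mathbb G:|x^{-1}y|<R\}$; in particular $B(0,|x|)=\{z:|z|<|x|\}$. All functions are measurable. *)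

theory Defs
  imports "HOL-Analysis.Analysis" "HOL-Algebra.Group"
begin

text \<open>A connected simply connected Lie group that admits dilations is nilpotent, so its exponential
  map is a diffeomorphism from the Lie algebra onto the group. As usual for homogeneous groups, the
  group is identified with its Lie algebra \<open>real ^ 'n\<close> through this map: the carrier is the whole
  space, the identity element is \<open>0\<close>, and the exponential map is the identity, that is, the
  one-parameter subgroup with initial velocity \<open>X\<close> is \<open>\<lambda>t. t *\<^sub>R X\<close>.\<close>

subsection \<open>Lie groups in exponential coordinates\<close>

text \<open>The \<open>C\<^sup>k\<close> functions on the whole space, via iterated directional derivatives.\<close>

primrec times_cont_differentiable ::
    "nat \<Rightarrow> ('a::real_normed_vector \<Rightarrow> 'b::real_normed_vector) \<Rightarrow> bool" where
  "times_cont_differentiable 0 f \<longleftrightarrow> continuous_on UNIV f"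
| "times_cont_differentiable (Suc k) f \<longleftrightarrow>
     (\<forall>x. f differentiable (at x)) \<and>
     (\<forall>v. times_cont_differentiable k (\<lambda>x. frechet_derivative f (at x) v))"

definition smooth :: "('a::real_normed_vector \<Rightarrow> 'b::real_normed_vector) \<Rightarrow> bool" where
  "smooth f \<longleftrightarrow> (\<forall>k. times_cont_differentiable k f)"

locale exp_lie_group = group G for G :: "(real ^ 'n::finite) monoid" (structure) +
  assumes carrier_UNIV: "carrier G = UNIV"
    and one_zero: "\<one> = 0"
    and smooth_mult: "smooth (\<lambda>(x, y). x \<otimes> y)"
    and smooth_inv: "smooth (\<lambda>x. inv x)"
    and exp_id: "(s *\<^sub>R X) \<otimes> (t *\<^sub>R X) = (s + t) *\<^sub>R X"

text \<open>The adjoint representation \<open>Ad\<close> is the derivative at the identity of conjugation, and the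
  Lie bracket of \<open>X\<close> and \<open>Y\<close> is \<open>ad X Y\<close>, where \<open>ad\<close> is the derivative of \<open>Ad\<close> at the identity.\<close>

definition Ad :: "(real ^ 'n::finite) monoid \<Rightarrow> real ^ 'n \<Rightarrow> real ^ 'n \<Rightarrow> real ^ 'n" where
  "Ad G g Y = frechet_derivative (\<lambda>z. g \<otimes>\<^bsub>G\<^esub> z \<otimes>\<^bsub>G\<^esub> inv\<^bsub>G\<^esub> g) (at 0) Y"

definition lie_bracket :: "(real ^ 'n::finite) monoid \<Rightarrow> real ^ 'n \<Rightarrow> real ^ 'n \<Rightarrow> real ^ 'n" where
  "lie_bracket G X Y = frechet_derivative (\<lambda>g. Ad G g Y) (at 0) X"

subsection \<open>Dilations\<close>

definition op_exp :: "('a::real_normed_vector \<Rightarrow> 'a) \<Rightarrow> 'a \<Rightarrow> 'a" where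
  "op_exp T x = (\<Sum>k. (1 / fact k) *\<^sub>R (T ^^ k) x)"

definition dilation :: "('a::real_normed_vector \<Rightarrow> 'a) \<Rightarrow> real \<Rightarrow> 'a \<Rightarrow> 'a" where
  "dilation A r = op_exp (\<lambda>x. ln r *\<^sub>R A x)"

definition diagonalisable :: "('a::real_vector \<Rightarrow> 'a) \<Rightarrow> bool" where
  "diagonalisable A \<longleftrightarrow>
     (\<exists>B. independent B \<and> span B = UNIV \<and> (\<forall>b\<in>B. \<exists>\<nu>. A b = \<nu> *\<^sub>R b))"

locale homogeneous_group = exp_lie_group G
  for G :: "(real ^ 'n::finite) monoid" (structure) +
  fixes A :: "real ^ 'n \<Rightarrow> real ^ 'n"
  assumes linear_A: "linear A"
    and diagonalisable_A: "diagonalisable A"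
    and pos_eigenvalues: "v \<noteq> 0 \<Longrightarrow> A v = \<nu> *\<^sub>R v \<Longrightarrow> \<nu> > 0"
    and linear_dilation: "r > 0 \<Longrightarrow> linear (dilation A r)"
    and dilation_lie_bracket: "r > 0 \<Longrightarrow>
      dilation A r (lie_bracket G X Y) = lie_bracket G (dilation A r X) (dilation A r Y)"

definition homogeneous_dimension :: "(real ^ 'n::finite \<Rightarrow> real ^ 'n) \<Rightarrow> real" where
  "homogeneous_dimension A = trace (matrix A)"

subsection \<open>Quasi-norms and quasi-balls\<close>

definition homogeneous_quasi_norm ::
    "(real ^ 'n::finite) monoid \<Rightarrow> (real ^ 'n \<Rightarrow> real ^ 'n) \<Rightarrow> (real ^ 'n \<Rightarrow> real) \<Rightarrow> bool" where
  "homogeneous_quasi_norm G A N \<longleftrightarrow>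
     continuous_on UNIV N \<and> (\<forall>x. N x \<ge> 0) \<and>
     (\<forall>x. N (inv\<^bsub>G\<^esub> x) = N x) \<and>
     (\<forall>r>0. \<forall>x. N (dilation A r x) = r * N x) \<and>
     (\<forall>x. N x = 0 \<longleftrightarrow> x = 0)"

definition quasi_ball ::
    "(real ^ 'n::finite) monoid \<Rightarrow> (real ^ 'n \<Rightarrow> real) \<Rightarrow> real ^ 'n \<Rightarrow> real \<Rightarrow> (real ^ 'n) set" where
  "quasi_ball G N x R = {y. N (inv\<^bsub>G\<^esub> x \<otimes>\<^bsub>G\<^esub> y) < R}"

subsection \<open>Weighted Hardy inequalities\<close>

text \<open>All integrals are of nonnegative functions with values in \<open>[0, \<infinity>]\<close>. The power function below
  is used with exponents \<open>r > 0\<close> only, for which \<open>\<infinity>\<close> to the power \<open>r\<close> is \<open>\<infinity>\<close>.\<close>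

definition ennreal_powr :: "ennreal \<Rightarrow> real \<Rightarrow> ennreal" where
  "ennreal_powr x r = (if x = \<infinity> then \<infinity> else ennreal (enn2real x powr r))"

text \<open>The inequality with constant \<open>C\<close>, where \<open>U x\<close> is the domain of the inner integral.\<close>

definition hardy_inequality ::
    "('a::euclidean_space \<Rightarrow> 'a set) \<Rightarrow> ('a \<Rightarrow> real) \<Rightarrow> ('a \<Rightarrow> real) \<Rightarrow> real \<Rightarrow> real \<Rightarrow> real \<Rightarrow> bool" where
  "hardy_inequality U \<phi> \<psi> p q C \<longleftrightarrow> C \<ge> 0 \<and>
     (\<forall>f :: 'a \<Rightarrow> real. f \<in> borel_measurable lebesgue \<longrightarrow> (AE x in lebesgue. f x \<ge> 0) \<longrightarrow>
        ennreal_powr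
          (\<integral>\<^sup>+x. ennreal_powr (\<integral>\<^sup>+z\<in>U x. ennreal (f z) \<partial>lebesgue) q * ennreal (\<phi> x) \<partial>lebesgue) (1 / q)
        \<le> ennreal C * ennreal_powr (\<integral>\<^sup>+x. ennreal (f x powr p * \<psi> x) \<partial>lebesgue) (1 / p))"

definition smallest_hardy_constant ::
    "('a::euclidean_space \<Rightarrow> 'a set) \<Rightarrow> ('a \<Rightarrow> real) \<Rightarrow> ('a \<Rightarrow> real) \<Rightarrow> real \<Rightarrow> real \<Rightarrow> real \<Rightarrow> bool" where
  "smallest_hardy_constant U \<phi> \<psi> p q C \<longleftrightarrow>
     hardy_inequality U \<phi> \<psi> p q C \<and> (\<forall>C'. hardy_inequality U \<phi> \<psi> p q C' \<longrightarrow> C \<le> C')"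

text \<open>Here \<open>V R\<close> and \<open>W R\<close> are the domains of integration of \<open>\<phi>\<close> and of the power of \<open>\<psi>\<close>,
  and \<open>p'\<close> is the exponent conjugate to \<open>p\<close>.\<close>

definition hardy_sup ::
    "(real \<Rightarrow> 'a set) \<Rightarrow> (real \<Rightarrow> 'a::euclidean_space set) \<Rightarrow> ('a \<Rightarrow> real) \<Rightarrow> ('a \<Rightarrow> real) \<Rightarrow>
     real \<Rightarrow> real \<Rightarrow> ennreal" where
  "hardy_sup V W \<phi> \<psi> p' q =
     (SUP R\<in>{0<..}.
        ennreal_powr (\<integral>\<^sup>+x\<in>V R. ennreal (\<phi> x) \<partial>lebesgue) (1 / q) *
        ennreal_powr (\<integral>\<^sup>+x\<in>W R. ennreal (\<psi> x powr (- (p' - 1))) \<partial>lebesgue) (1 / p'))"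

end

theory Submission
  imports Defs
begin

text \<open>Both inequalities concern the operator that integrates \<open>f\<close> over a sublevel set
  \<open>{z. t z \<le> t x}\<close>, with \<open>t = N\<close> or \<open>t = - N\<close>: spheres of the quasi-norm are null sets, so
  strict and weak inequalities need not be distinguished. Let \<open>V r\<close> be the integral of \<open>\<phi>\<close> over
  \<open>{t \<ge> r}\<close> and \<open>W r\<close> that of \<open>w = \<psi> powr (1 - p')\<close> over \<open>{t \<le> r}\<close>, so that
  \<open>V powr (1 / q) * W powr (1 / p') \<le> A\<close>.

  For sufficiency, Jensen's inequality with respect to the weight \<open>w * W powr (-1 / p)\<close>, which has
  integral at most \<open>p' * W r powr (1 / p')\<close> over \<open>{t \<le> r}\<close>, bounds the \<open>p\<close>-th power of the inner
  integral by an integral of \<open>f powr p * \<psi> * W powr (1 / p')\<close>. After \<open>W powr (1 / p')\<close> is replaced by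
  \<open>A * V powr (-1 / q)\<close>, Jensen's inequality with exponent \<open>q / p\<close> and weight \<open>f powr p * \<psi>\<close>, Tonelli's
  theorem and the bound \<open>p * V r powr (1 / p)\<close> for the integral of \<open>\<phi> * V powr (-1 / p')\<close> over
  \<open>{t \<ge> r}\<close> give the constant. For necessity, the inequality is tested on bounded truncations of
  \<open>w\<close> on \<open>{t \<le> r}\<close>.\<close>


subsection \<open>Jensen's inequality for extended nonnegative integrals\<close>

lemma ennreal_powr_ennreal: "0 \<le> x \<Longrightarrow> ennreal_powr (ennreal x) r = ennreal (x powr r)"
  by (simp add: ennreal_powr_def)

lemma ennreal_powr_top [simp]: "ennreal_powr Orderings.top r = Orderings.top"
  by (simp add: ennreal_powr_def)

lemma ennreal_powr_mono:
  assumes "0 < r" "x \<le> y" shows "ennreal_powr x r \<le> ennreal_powr y r"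
proof (cases "y = Orderings.top")
  case False
  then have "x \<noteq> Orderings.top" using assms top.extremum_unique by auto
  with False assms show ?thesis
    by (auto simp: ennreal_powr_def intro!: ennreal_leI powr_mono2 enn2real_mono simp: top.not_eq_extremum)
qed simp

lemma ennreal_powr_powr: "ennreal_powr (ennreal_powr x r) s = ennreal_powr x (r * s)"
  by (cases x) (simp_all add: ennreal_powr_ennreal powr_powr)

lemma ennreal_powr_one [simp]: "ennreal_powr x 1 = x"
  by (cases x) (simp_all add: ennreal_powr_ennreal)

lemma ennreal_powr_eq_0_iff: "ennreal_powr x r = 0 \<longleftrightarrow> x = 0"
  by (cases x) (simp_all add: ennreal_powr_ennreal)

lemma ennreal_powr_less_top_iff: "ennreal_powr x r < Orderings.top \<longleftrightarrow> x < Orderings.top"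
  by (cases x) (simp_all add: ennreal_powr_ennreal)

lemma ennreal_powr_mult:
  assumes "0 < r" shows "ennreal_powr (x * y) r = ennreal_powr x r * ennreal_powr y r"
proof (cases "x = 0 \<or> y = 0")
  case True
  then show ?thesis using ennreal_powr_eq_0_iff[of 0 r] by auto
next
  case False
  then show ?thesis
    by (cases x; cases y)
      (auto simp: ennreal_powr_ennreal powr_mult ennreal_top_mult ennreal_mult_top
        ennreal_mult[symmetric] ennreal_powr_eq_0_iff)
qed

text \<open>The power \<open>1 / r\<close> is a monotone inverse of the power \<open>r\<close>, so
  bounding the powers is the same as bounding the values. This lets monotone convergence pass
  through outer exponents.\<close>

lemma ennreal_powr_SUP:
  assumes "0 < r"
  shows "ennreal_powr (SUP i\<in>I. f i) r = (SUP i\<in>I. ennreal_powr (f i) r)"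
proof (rule antisym)
  let ?S = "SUP i\<in>I. ennreal_powr (f i) r"
  have "f i \<le> ennreal_powr ?S (1 / r)" if "i \<in> I" for i
  proof -
    have "ennreal_powr (ennreal_powr (f i) r) (1 / r) \<le> ennreal_powr ?S (1 / r)"
      using assms that by (intro ennreal_powr_mono SUP_upper) auto
    then show ?thesis using assms by (simp add: ennreal_powr_powr)
  qed
  then have "(SUP i\<in>I. f i) \<le> ennreal_powr ?S (1 / r)" by (rule SUP_least)
  then have "ennreal_powr (SUP i\<in>I. f i) r \<le> ennreal_powr (ennreal_powr ?S (1 / r)) r"
    using assms by (intro ennreal_powr_mono)
  then show "ennreal_powr (SUP i\<in>I. f i) r \<le> ?S" using assms by (simp add: ennreal_powr_powr)
  show "?S \<le> ennreal_powr (SUP i\<in>I. f i) r"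
    using assms by (intro SUP_least ennreal_powr_mono SUP_upper)
qed

lemma borel_measurable_ennreal_powr [measurable]: "(\<lambda>x. ennreal_powr x r) \<in> borel_measurable borel"
  unfolding ennreal_powr_def by measurable

text \<open>By convexity \<open>v powr s\<close> lies above its tangent at \<open>a\<close>. The
  constant term of the tangent is nonpositive and is moved to the other side, so that the bound can
  be integrated in \<open>ennreal\<close>.\<close>

lemma powr_tangent_bound:
  fixes a s v :: real
  assumes "0 < a" "0 \<le> v" "1 \<le> s"
  shows "s * a powr (s - 1) * v \<le> v powr s + (s - 1) * a powr s"
proof (cases "s = 1 \<or> v = 0")
  case True
  then show ?thesis using assms by auto
next
  case False
  then have s: "1 < s" and v: "0 < v" using assms by auto
  \<comment> \<open>Scaling by \<open>a\<close> reduces the claim to Bernoulli's inequality, which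
    says that \<open>g\<close> has its minimum over positive arguments at \<open>1\<close>.\<close>
  have "1 + s * (v / a - 1) \<le> (v / a) powr s"
  proof -
    define g where "g = (\<lambda>y::real. y powr s - s * y)"
    have "g 1 \<le> g (v / a)"
    proof -
      have d: "(g has_real_derivative s * y powr (s - 1) - s) (at y)" if "0 < y" for y
        unfolding g_def using that by (auto intro!: derivative_eq_intros)
      show ?thesis
      proof (cases "v / a \<le> 1")
        case True
        show ?thesis
        proof (rule DERIV_nonpos_imp_nonincreasing[OF True])
          fix y assume y: "v / a \<le> y" "y \<le> 1"
          then have "0 < y" using v assms by (auto intro: less_le_trans[of 0 "v / a"])
          moreover have "y powr (s - 1) \<le> 1" using y \<open>0 < y\<close> s by (intro powr_le1) auto
          ultimately show "\<exists>l. DERIV g y :> l \<and> l \<le> 0"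
            using d[of y] s by (intro exI[of _ "s * y powr (s - 1) - s"]) auto
        qed
      next
        case False
        show ?thesis
        proof (rule DERIV_nonneg_imp_nondecreasing[of 1 "v / a" g])
          show "1 \<le> v / a" using False by simp
        next
          fix y assume y: "1 \<le> y" "y \<le> v / a"
          then have "1 \<le> y powr (s - 1)" using s by (intro ge_one_powr_ge_zero) auto
          then show "\<exists>l. DERIV g y :> l \<and> 0 \<le> l"
            using d[of y] y s by (intro exI[of _ "s * y powr (s - 1) - s"]) auto
        qed
      qed
    qed
    then show ?thesis by (simp add: g_def algebra_simps)
  qed
  then have "a powr s * (1 + s * (v / a - 1)) \<le> a powr s * (v / a) powr s"
    by (intro mult_left_mono) auto
  moreover have "a powr s * (v / a) powr s = v powr s"
    using assms by (simp flip: powr_mult)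
  moreover have "a powr s = a powr (s - 1) * a"
    using assms powr_mult_base[of a "s - 1"] by (simp add: mult.commute)
  moreover have "a powr (s - 1) * a * (1 + s * (v / a - 1))
      = s * a powr (s - 1) * v - (s - 1) * (a powr (s - 1) * a)"
    using assms by (simp add: field_simps)
  ultimately show ?thesis by simp
qed

text \<open>The tangent bound is integrated against \<open>m\<close>, with the tangent point at the
  integral of \<open>m * v\<close> divided by \<open>K\<close>. Allowing any total mass up to
  \<open>K\<close> gives a form of Hoelder's inequality that fits different weights.\<close>

lemma nn_integral_jensen_powr:
  assumes [measurable]: "m \<in> borel_measurable M" "v \<in> borel_measurable M"
    and v: "\<And>x. 0 \<le> v x" and s: "1 \<le> s" and K: "0 \<le> K" "(\<integral>\<^sup>+x. m x \<partial>M) \<le> ennreal K"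
  shows "ennreal_powr (\<integral>\<^sup>+x. m x * ennreal (v x) \<partial>M) s
    \<le> ennreal (K powr (s - 1)) * (\<integral>\<^sup>+x. m x * ennreal (v x powr s) \<partial>M)"
    (is "ennreal_powr ?I s \<le> _ * ?J")
proof (cases "?I = 0")
  case True
  then show ?thesis by (simp add: ennreal_powr_def)
next
  case False
  have K0: "0 < K"
  proof (rule ccontr)
    assume "\<not> 0 < K"
    with K have "(\<integral>\<^sup>+x. m x \<partial>M) = 0" by (simp add: ennreal_neg)
    then have "AE x in M. m x = 0" by (simp add: nn_integral_0_iff_AE)
    then have "?I = 0" by (subst nn_integral_0_iff_AE) auto
    with False show False by simp
  qed
  \<comment> \<open>The tangent point stays free: \<open>a = 1\<close> shows that \<open>?I\<close>
    is finite if \<open>?J\<close> is, and only then can the optimal point \<open>i / K\<close> be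
    formed.\<close>
  have *: "ennreal (s * a powr (s - 1)) * ?I \<le> ?J + ennreal ((s - 1) * a powr s * K)" if "0 < a" for a
  proof -
    have "ennreal (s * a powr (s - 1)) * ?I = (\<integral>\<^sup>+x. m x * ennreal (s * a powr (s - 1) * v x) \<partial>M)"
      using s v by (subst nn_integral_cmult[symmetric]) (auto simp: ennreal_mult' mult_ac)
    also have "\<dots> \<le> (\<integral>\<^sup>+x. m x * ennreal (v x powr s) + ennreal ((s - 1) * a powr s) * m x \<partial>M)"
    proof (intro nn_integral_mono)
      fix x
      have "m x * ennreal (s * a powr (s - 1) * v x) \<le> m x * ennreal (v x powr s + (s - 1) * a powr s)"
        by (intro mult_left_mono ennreal_leI powr_tangent_bound that v s) auto
      also have "\<dots> = m x * ennreal (v x powr s) + ennreal ((s - 1) * a powr s) * m x"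
        using s by (simp add: ennreal_plus distrib_left mult.commute)
      finally show "m x * ennreal (s * a powr (s - 1) * v x) \<le> \<dots>" .
    qed
    also have "\<dots> = ?J + ennreal ((s - 1) * a powr s) * (\<integral>\<^sup>+x. m x \<partial>M)"
      by (simp add: nn_integral_add nn_integral_cmult)
    also have "\<dots> \<le> ?J + ennreal ((s - 1) * a powr s * K)"
      using K s by (auto simp: ennreal_mult intro!: add_left_mono mult_left_mono)
    finally show ?thesis .
  qed
  show ?thesis
  proof (cases "?J = Orderings.top")
    case True
    then show ?thesis using K0 by (simp add: ennreal_mult_top)
  next
    case J: False
    have "?I \<noteq> Orderings.top"
    proof
      assume "?I = Orderings.top"
      with *[of 1] s have "Orderings.top \<le> ?J + ennreal ((s - 1) * K)" by (simp add: ennreal_mult_top)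
      with J show False by (simp add: top_unique)
    qed
    then obtain i where i: "?I = ennreal i" "0 \<le> i" by (cases ?I) auto
    from J obtain j where j: "?J = ennreal j" "0 \<le> j" by (cases ?J) auto
    have i0: "0 < i" using i False by (cases "i = 0") auto
    define a where "a = i / K"
    have a: "0 < a" using i0 K0 by (simp add: a_def)
    have "ennreal (s * a powr (s - 1) * i) \<le> ennreal (j + (s - 1) * a powr s * K)"
      using *[OF a] i j s K by (simp add: ennreal_mult' ennreal_plus)
    then have "s * a powr (s - 1) * i \<le> j + (s - 1) * a powr s * K"
      using j s K by (subst (asm) ennreal_le_iff) auto
    \<comment> \<open>At \<open>a = i / K\<close> the last term equals \<open>s - 1\<close> times
      \<open>a powr (s - 1) * i\<close>, which leaves one such term on the left.\<close>
    moreover have "a powr s * K = a powr (s - 1) * i"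
    proof -
      have "a powr s = a * a powr (s - 1)" using a powr_mult_base[of a "s - 1"] by simp
      then show ?thesis using K0 by (simp add: a_def)
    qed
    moreover from this have "(s - 1) * a powr s * K = (s - 1) * (a powr (s - 1) * i)" by simp
    ultimately have "a powr (s - 1) * i \<le> j" by (simp add: left_diff_distrib mult.assoc)
    then have "K powr (s - 1) * (a powr (s - 1) * i) \<le> K powr (s - 1) * j" by (intro mult_left_mono) auto
    moreover have "K powr (s - 1) * (a powr (s - 1) * i) = i powr s"
    proof -
      have "K powr (s - 1) * a powr (s - 1) = i powr (s - 1)"
        using K0 a by (simp add: a_def flip: powr_mult)
      then show ?thesis using i0 powr_mult_base[of i "s - 1"] by (simp add: mult.commute mult.left_commute flip: mult.assoc)
    qed
    ultimately show ?thesis using i j by (simp add: ennreal_powr_ennreal flip: ennreal_mult)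
  qed
qed

subsection \<open>Integrals of powers of a distribution function\<close>

text \<open>The hypotheses say that \<open>X\<close> stochastically dominates the uniform distribution on \<open>[0, K]\<close>,
  for which the bound is attained. The layer cake formula transfers it to \<open>X\<close>.\<close>

lemma nn_integral_powr_neg_le:
  assumes "sigma_finite_measure M"
    and [measurable]: "X \<in> borel_measurable M" "w \<in> borel_measurable M"
    and X: "\<And>z. 0 \<le> X z" and a: "0 < a" "a < (1::real)" and K: "0 \<le> K"
    and wK: "(\<integral>\<^sup>+z. w z \<partial>M) \<le> ennreal K"
    and wX: "\<And>v. 0 < v \<Longrightarrow> (\<integral>\<^sup>+z. w z * indicator {z. X z \<le> v} z \<partial>M) \<le> ennreal v"
  shows "(\<integral>\<^sup>+z. w z * ennreal (X z powr (-a)) \<partial>M) \<le> ennreal (K powr (1 - a) / (1 - a))"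
proof -
  interpret M: sigma_finite_measure M by fact
  interpret pair_sigma_finite lborel M ..
  \<comment> \<open>\<open>k\<close> is the density of the layer cake formula: for positive
    \<open>u\<close> its integral over \<open>{u..}\<close> is \<open>u powr (-a)\<close>.\<close>
  define k where "k = (\<lambda>v::real. ennreal (a * v powr (- a - 1)) * indicator {0<..} v)"
  have [measurable]: "k \<in> borel_measurable borel" unfolding k_def by measurable
  have layer: "(\<integral>\<^sup>+v. k v * indicator {u..} v \<partial>lborel) = ennreal (u powr (-a))" if "0 < u" for u
  proof -
    have "((\<lambda>v. a * v powr (- a - 1)) has_integral a * (- (u powr (- a - 1 + 1)) / (- a - 1 + 1))) {u..}"
      using that a by (intro has_integral_mult_right has_integral_powr_to_inf) auto
    then have "(\<integral>\<^sup>+v. ennreal (a * v powr (- a - 1)) * indicator {u..} v \<partial>lborel)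
        = ennreal (a * (- (u powr (- a - 1 + 1)) / (- a - 1 + 1)))"
      using a by (intro nn_integral_has_integral_lebesgue') auto
    also have "(\<integral>\<^sup>+v. ennreal (a * v powr (- a - 1)) * indicator {u..} v \<partial>lborel)
        = (\<integral>\<^sup>+v. k v * indicator {u..} v \<partial>lborel)"
      using that by (intro nn_integral_cong) (auto simp: k_def indicator_def)
    finally show ?thesis using a by simp
  qed
  have "(\<integral>\<^sup>+z. w z * ennreal (X z powr (-a)) \<partial>M)
      \<le> (\<integral>\<^sup>+z. (\<integral>\<^sup>+v. k v * (w z * indicator {z. X z \<le> v} z) \<partial>lborel) \<partial>M)"
  proof (intro nn_integral_mono)
    fix z
    \<comment> \<open>Only an inequality: where \<open>X z = 0\<close> the left side vanishes, since
      \<open>0 powr (-a) = 0\<close>.\<close>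
    have "ennreal (X z powr (-a)) \<le> (\<integral>\<^sup>+v. k v * indicator {X z..} v \<partial>lborel)"
      using layer[of "X z"] X[of z] by (cases "X z = 0") auto
    then have "w z * ennreal (X z powr (-a)) \<le> w z * (\<integral>\<^sup>+v. k v * indicator {X z..} v \<partial>lborel)"
      by (intro mult_left_mono) auto
    also have "\<dots> = (\<integral>\<^sup>+v. k v * (w z * indicator {z. X z \<le> v} z) \<partial>lborel)"
      by (subst nn_integral_cmult[symmetric]) (auto simp: indicator_def mult_ac intro!: nn_integral_cong)
    finally show "w z * ennreal (X z powr (-a)) \<le> \<dots>" .
  qed
  also have "\<dots> = (\<integral>\<^sup>+v. (\<integral>\<^sup>+z. k v * (w z * indicator {z. X z \<le> v} z) \<partial>M) \<partial>lborel)"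
    by (rule Fubini') measurable
  also have "\<dots> = (\<integral>\<^sup>+v. k v * (\<integral>\<^sup>+z. w z * indicator {z. X z \<le> v} z \<partial>M) \<partial>lborel)"
    by (intro nn_integral_cong nn_integral_cmult) measurable
  \<comment> \<open>The two hypotheses give the bound \<open>min v K\<close>, which is the Lebesgue
    measure of \<open>{0<..min v K}\<close>. This replaces \<open>X\<close> by a uniform variable,
    and the remaining steps undo the layer cake formula for the latter.\<close>
  also have "\<dots> \<le> (\<integral>\<^sup>+v. k v * (\<integral>\<^sup>+u. indicator {0<..K} u * indicator {u. u \<le> v} u \<partial>lborel) \<partial>lborel)"
  proof (intro nn_integral_mono)
    fix v :: real
    show "k v * (\<integral>\<^sup>+z. w z * indicator {z. X z \<le> v} z \<partial>M)
      \<le> k v * (\<integral>\<^sup>+u. indicator {0<..K} u * indicator {u. u \<le> v} u \<partial>lborel)"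
    proof (cases "0 < v")
      case True
      have "(\<integral>\<^sup>+z. w z * indicator {z. X z \<le> v} z \<partial>M) \<le> (\<integral>\<^sup>+z. w z \<partial>M)"
        by (intro nn_integral_mono) (auto simp: indicator_def)
      then have "(\<integral>\<^sup>+z. w z * indicator {z. X z \<le> v} z \<partial>M) \<le> ennreal (min v K)"
        using wX[OF True] wK by (auto simp: min_def)
      also have "ennreal (min v K) = emeasure lborel {0<..min v K}"
        using True K by simp
      also have "\<dots> = (\<integral>\<^sup>+u. indicator {0<..min v K} u \<partial>lborel)"
        by simp
      also have "\<dots> = (\<integral>\<^sup>+u. indicator {0<..K} u * indicator {u. u \<le> v} u \<partial>lborel)"
        by (intro nn_integral_cong) (auto simp: indicator_def)
      finally show ?thesis by (rule mult_left_mono) simp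
    qed (simp add: k_def)
  qed
  also have "\<dots> = (\<integral>\<^sup>+v. (\<integral>\<^sup>+u. k v * (indicator {0<..K} u * indicator {u. u \<le> v} u) \<partial>lborel) \<partial>lborel)"
    by (intro nn_integral_cong nn_integral_cmult[symmetric]) measurable
  also have "\<dots> = (\<integral>\<^sup>+u. (\<integral>\<^sup>+v. k v * (indicator {0<..K} u * indicator {u. u \<le> v} u) \<partial>lborel) \<partial>lborel)"
    by (rule lborel_pair.Fubini') measurable
  also have "\<dots> = (\<integral>\<^sup>+u. ennreal (u powr (-a)) * indicator {0..K} u \<partial>lborel)"
  proof (intro nn_integral_cong)
    fix u :: real
    have "(\<integral>\<^sup>+v. k v * (indicator {0<..K} u * indicator {u. u \<le> v} u) \<partial>lborel)
        = (\<integral>\<^sup>+v. indicator {0<..K} u * (k v * indicator {u..} v) \<partial>lborel)"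
      by (intro nn_integral_cong) (auto simp: indicator_def)
    also have "\<dots> = indicator {0<..K} u * (\<integral>\<^sup>+v. k v * indicator {u..} v \<partial>lborel)"
      by (rule nn_integral_cmult) measurable
    also have "\<dots> = ennreal (u powr (-a)) * indicator {0..K} u"
      using layer[of u] by (cases "u = 0") (auto simp: indicator_def)
    finally show "(\<integral>\<^sup>+v. k v * (indicator {0<..K} u * indicator {u. u \<le> v} u) \<partial>lborel) = \<dots>" .
  qed
  also have "\<dots> = ennreal (K powr (- a + 1) / (- a + 1))"
    using a K by (intro nn_integral_has_integral_lebesgue' has_integral_powr_from_0) auto
  finally show ?thesis by simp
qed

context
  fixes M :: "'a measure" and t :: "'a \<Rightarrow> real" and w :: "'a \<Rightarrow> ennreal"
  assumes sf: "sigma_finite_measure M"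
    and t [measurable]: "t \<in> borel_measurable M" and w [measurable]: "w \<in> borel_measurable M"
begin

lemma borel_measurable_nn_integral_sublevel:
  "(\<lambda>x. \<integral>\<^sup>+z. w z * indicator {z. t z \<le> t x} z \<partial>M) \<in> borel_measurable M"
proof -
  interpret sigma_finite_measure M by (rule sf)
  show ?thesis by measurable
qed

text \<open>This supplies the domination of the uniform distribution by the values of
  \<open>W\<close> at \<open>t\<close>. The set \<open>L\<close> is an initial segment of the line.
  If \<open>Sup L\<close> belongs to \<open>L\<close>, the integral is at most
  \<open>W (Sup L)\<close>; otherwise it is approximated by \<open>W\<close> at points of
  \<open>L\<close>. As \<open>W\<close> may jump, the cases are separate.\<close>

lemma nn_integral_sublevel_le:
  defines "W \<equiv> \<lambda>r. \<integral>\<^sup>+z. w z * indicator {z. t z \<le> r} z \<partial>M"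
  shows "(\<integral>\<^sup>+z. w z * indicator {z. t z \<le> r \<and> W (t z) \<le> v} z \<partial>M) \<le> v"
proof -
  define L where "L = {s. s \<le> r \<and> W s \<le> v}"
  have down: "s' \<in> L" if "s \<in> L" "s' \<le> s" for s s'
  proof -
    have "W s' \<le> W s" unfolding W_def
      using that by (intro nn_integral_mono) (auto simp: indicator_def)
    with that show ?thesis by (auto simp: L_def)
  qed
  have le: "(\<integral>\<^sup>+z. w z * indicator {z. t z \<le> r \<and> W (t z) \<le> v} z \<partial>M) \<le> W' "
    if "\<And>z. t z \<in> L \<Longrightarrow> w z \<le> g z" "W' = (\<integral>\<^sup>+z. g z \<partial>M)" for W' g
    unfolding that(2) using that(1) by (intro nn_integral_mono) (auto simp: indicator_def L_def)
  show ?thesis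
  proof (cases "L = {}")
    case True
    then show ?thesis using le[of "\<lambda>_. 0" 0] by simp
  next
    case False
    have bdd: "bdd_above L" by (auto simp: L_def bdd_above_def)
    show ?thesis
    proof (cases "Sup L \<in> L")
      case True
      have "(\<integral>\<^sup>+z. w z * indicator {z. t z \<le> r \<and> W (t z) \<le> v} z \<partial>M) \<le> W (Sup L)"
        by (rule le[OF _ W_def[THEN meta_eq_to_obj_eq, THEN fun_cong]])
          (auto simp: indicator_def dest: cSup_upper[OF _ bdd])
      also have "\<dots> \<le> v" using True by (simp add: L_def)
      finally show ?thesis .
    next
      case notin: False
      \<comment> \<open>These points lie strictly below \<open>Sup L\<close>, hence in
        \<open>L\<close>, and every \<open>t z\<close> in \<open>L\<close> lies below one of them
        because the supremum is not attained.\<close>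
      define s where "s = (\<lambda>n. Sup L - inverse (real (Suc n)))"
      have s: "s n \<in> L" for n
      proof -
        have "s n < Sup L" by (simp add: s_def)
        then obtain s' where "s' \<in> L" "s n < s'" using less_cSup_iff[OF False bdd] by blast
        then show ?thesis using down by auto
      qed
      have "(\<integral>\<^sup>+z. w z * indicator {z. t z \<le> r \<and> W (t z) \<le> v} z \<partial>M)
          \<le> (\<integral>\<^sup>+z. (SUP n. w z * indicator {z. t z \<le> s n} z) \<partial>M)"
      proof (rule le[OF _ refl])
        fix z assume z: "t z \<in> L"
        then have "t z \<noteq> Sup L" using notin by auto
        then have "t z < Sup L" using z cSup_upper[OF z bdd] by linarith
        then obtain n where "inverse (real (Suc n)) < Sup L - t z"
          using reals_Archimedean[of "Sup L - t z"] by auto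
        then have "w z = w z * indicator {z. t z \<le> s n} z" by (auto simp: s_def)
        also have "\<dots> \<le> (SUP n. w z * indicator {z. t z \<le> s n} z)" by (rule SUP_upper) simp
        finally show "w z \<le> \<dots>" .
      qed
      also have "\<dots> = (SUP n. \<integral>\<^sup>+z. w z * indicator {z. t z \<le> s n} z \<partial>M)"
      proof (rule nn_integral_monotone_convergence_SUP)
        have "s n \<le> s (Suc n)" for n by (auto simp: s_def intro!: le_imp_inverse_le)
        then have "incseq s" by (rule incseq_SucI)
        then show "incseq (\<lambda>n z. w z * indicator {z. t z \<le> s n} z)"
          by (auto simp: incseq_def le_fun_def indicator_def intro: order_trans)
      qed measurable
      also have "\<dots> \<le> v" using s by (intro SUP_least) (auto simp: L_def W_def)
      finally show ?thesis .
    qed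
  qed
qed

text \<open>In the smooth case the substitution \<open>y = W (t z)\<close> turns the left side into
  the integral of \<open>y powr (-a)\<close> from \<open>0\<close> to \<open>W r\<close>. In general
  the comparison with the uniform distribution on \<open>[0, W r]\<close> gives the
  inequality.\<close>

lemma nn_integral_distribution_powr_neg_le:
  defines "W \<equiv> \<lambda>r. \<integral>\<^sup>+z. w z * indicator {z. t z \<le> r} z \<partial>M"
  assumes a: "0 < a" "a < (1::real)" and fin: "W r < \<infinity>"
  shows "(\<integral>\<^sup>+z. w z * ennreal (enn2real (W (t z)) powr (-a)) * indicator {z. t z \<le> r} z \<partial>M)
    \<le> ennreal (enn2real (W r) powr (1 - a) / (1 - a))"
proof -
  have [measurable]: "(\<lambda>z. W (t z)) \<in> borel_measurable M"
    unfolding W_def by (rule borel_measurable_nn_integral_sublevel)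
  \<comment> \<open>Finiteness guards the passage to reals, since \<open>enn2real\<close> sends
    \<open>\<infinity>\<close> to \<open>0\<close>.\<close>
  have fin': "W (t z) < \<infinity>" if "t z \<le> r" for z
  proof -
    have "W (t z) \<le> W r" unfolding W_def
      using that by (intro nn_integral_mono) (auto simp: indicator_def)
    from this fin show ?thesis by (rule le_less_trans)
  qed
  have "(\<integral>\<^sup>+z. (w z * indicator {z. t z \<le> r} z) * ennreal (enn2real (W (t z)) powr (-a)) \<partial>M)
    \<le> ennreal (enn2real (W r) powr (1 - a) / (1 - a))"
  proof (rule nn_integral_powr_neg_le[OF sf])
    show "(\<integral>\<^sup>+z. w z * indicator {z. t z \<le> r} z \<partial>M) \<le> ennreal (enn2real (W r))"
      using fin by (simp add: W_def)
    fix v :: real assume v: "0 < v"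
    have "(\<integral>\<^sup>+z. w z * indicator {z. t z \<le> r} z * indicator {z. enn2real (W (t z)) \<le> v} z \<partial>M)
       \<le> (\<integral>\<^sup>+z. w z * indicator {z. t z \<le> r \<and> W (t z) \<le> ennreal v} z \<partial>M)"
    proof (intro nn_integral_mono)
      fix z
      have "W (t z) \<le> ennreal v" if "t z \<le> r" "enn2real (W (t z)) \<le> v"
        using fin'[OF that(1)] that(2) by (metis ennreal_enn2real ennreal_leI infinity_ennreal_def)
      then show "w z * indicator {z. t z \<le> r} z * indicator {z. enn2real (W (t z)) \<le> v} z
        \<le> w z * indicator {z. t z \<le> r \<and> W (t z) \<le> ennreal v} z"
        by (auto simp: indicator_def)
    qed
    also have "\<dots> \<le> ennreal v" unfolding W_def by (rule nn_integral_sublevel_le)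
    finally show "(\<integral>\<^sup>+z. w z * indicator {z. t z \<le> r} z * indicator {z. enn2real (W (t z)) \<le> v} z \<partial>M)
      \<le> ennreal v" .
  qed (use a in auto)
  then show ?thesis by (simp add: mult_ac)
qed

end

subsection \<open>Hardy inequalities on sublevel sets\<close>

lemma conjugate_exponent:
  fixes p p' :: real
  assumes "1 < p" "1 / p + 1 / p' = 1"
  shows "p' = p / (p - 1)" "1 < p'"
proof -
  have "1 / p' = (p - 1) / p" using assms by (simp add: field_simps)
  then show *: "p' = p / (p - 1)" using assms by (metis inverse_divide inverse_eq_divide inverse_inverse_eq)
  show "1 < p'" using assms(1) by (simp add: * field_simps)
qed

text \<open>This is the sufficiency raised to the power \<open>q\<close>: the constant is the
  \<open>q\<close>-th power of \<open>p' powr (1 / p') * p powr (1 / q) * a\<close>. Bounds on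
  \<open>V\<close> and \<open>W\<close> are asked only at \<open>t x\<close> for almost every
  \<open>x\<close>, which is what a supremum over \<open>R > 0\<close> can provide.\<close>

lemma hardy_sublevel:
  fixes M :: "'a measure" and t \<phi> \<psi> f :: "'a \<Rightarrow> real" and a p p' q :: real
  defines "V \<equiv> \<lambda>r. \<integral>\<^sup>+x. ennreal (\<phi> x) * indicator {x. r \<le> t x} x \<partial>M"
    and "W \<equiv> \<lambda>r. \<integral>\<^sup>+x. ennreal (\<psi> x powr (- (p' - 1))) * indicator {x. t x \<le> r} x \<partial>M"
  assumes sf: "sigma_finite_measure M"
    and t [measurable]: "t \<in> borel_measurable M"
    and \<phi> [measurable]: "\<phi> \<in> borel_measurable M" and \<phi>_pos: "\<And>x. 0 < \<phi> x"
    and \<psi> [measurable]: "\<psi> \<in> borel_measurable M" and \<psi>_pos: "\<And>x. 0 < \<psi> x"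
    and pq: "1 < p" "p \<le> q" "1 / p + 1 / p' = 1"
    and a: "0 < a"
    and V: "AE x in M. 0 < V (t x) \<and> V (t x) < \<infinity>"
    and W: "AE x in M. 0 < W (t x) \<and> W (t x) < \<infinity>"
    and VW: "AE x in M. ennreal_powr (V (t x)) (1 / q) * ennreal_powr (W (t x)) (1 / p') \<le> ennreal a"
    and f [measurable]: "f \<in> borel_measurable M" and f_nonneg: "\<And>x. 0 \<le> f x"
  shows "(\<integral>\<^sup>+x. ennreal_powr (\<integral>\<^sup>+z. ennreal (f z) * indicator {z. t z \<le> t x} z \<partial>M) q * ennreal (\<phi> x) \<partial>M)
    \<le> ennreal (p' powr (q / p') * p * a powr q) *
       ennreal_powr (\<integral>\<^sup>+x. ennreal (f x powr p * \<psi> x) \<partial>M) (q / p)"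
    (is "?L \<le> ennreal ?c * ennreal_powr ?I _")
proof (cases "?I = \<infinity>")
  case True
  have "1 < p'" using conjugate_exponent pq by blast
  \<comment> \<open>Positivity makes the right side infinite, as
    \<open>0 * \<infinity> = 0\<close>.\<close>
  then have "0 < ?c" using pq a by simp
  then have "ennreal ?c * \<infinity> = \<infinity>"
    by (metis ennreal_eq_0_iff ennreal_mult_top infinity_ennreal_def not_le)
  then show ?thesis by (simp only: True ennreal_powr_def simp_thms if_True infinity_ennreal_def top_greatest)
next
  case False
  interpret sigma_finite_measure M by (rule sf)
  interpret pair_sigma_finite M M ..
  define s where "s = q / p"
  define i where "i = enn2real ?I"
  have I: "?I = ennreal i" and i: "0 \<le> i" using False by (auto simp: i_def less_top)
  have q: "0 < q" and p: "0 < p" and s1: "1 \<le> s" using pq by (auto simp: s_def)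
  note p'_eq = conjugate_exponent(1)[OF pq(1,3)] and p' = conjugate_exponent(2)[OF pq(1,3)]
  have conj: "1 - 1 / p = 1 / p'" "1 - 1 / p' = 1 / p" using pq by auto
  have conj': "(p - 1) / p = 1 / p'" "(p' - 1) * p = p'"
    using pq by (auto simp: p'_eq field_simps)
  define v where "v = (\<lambda>x. enn2real (V (t x)))"
  define u where "u = (\<lambda>x. enn2real (W (t x)))"
  have [measurable]: "(\<lambda>x. V (t x)) \<in> borel_measurable M" "(\<lambda>x. W (t x)) \<in> borel_measurable M"
    unfolding V_def W_def by measurable
  have [measurable]: "v \<in> borel_measurable M" "u \<in> borel_measurable M"
    unfolding v_def u_def by measurable
  have good: "AE x in M. 0 < u x \<and> 0 < v x \<and> W (t x) < \<infinity> \<and> V (t x) < \<infinity> \<and>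
      u x powr (1 / p') \<le> a * v x powr (- (1 / q))"
    using V W VW
  proof eventually_elim
    fix x assume *: "0 < V (t x) \<and> V (t x) < \<infinity>" "0 < W (t x) \<and> W (t x) < \<infinity>"
      "ennreal_powr (V (t x)) (1 / q) * ennreal_powr (W (t x)) (1 / p') \<le> ennreal a"
    then have uv: "0 < u x" "0 < v x" "V (t x) = ennreal (v x)" "W (t x) = ennreal (u x)"
      by (auto simp: u_def v_def enn2real_positive_iff)
    with * a have "v x powr (1 / q) * u x powr (1 / p') \<le> a"
      by (simp add: ennreal_powr_ennreal less_imp_le flip: ennreal_mult)
    then have "u x powr (1 / p') \<le> a * v x powr (- (1 / q))"
      using uv by (simp add: powr_minus field_simps)
    with uv * show "0 < u x \<and> 0 < v x \<and> W (t x) < \<infinity> \<and> V (t x) < \<infinity> \<and>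
      u x powr (1 / p') \<le> a * v x powr (- (1 / q))" by simp
  qed
  define F where "F = (\<lambda>x. \<integral>\<^sup>+z. ennreal (f z) * indicator {z. t z \<le> t x} z \<partial>M)"
  define g where "g = (\<lambda>z. f z powr p * \<psi> z)"
  have g: "0 \<le> g z" for z unfolding g_def using less_imp_le[OF \<psi>_pos] by simp
  have [measurable]: "g \<in> borel_measurable M" unfolding g_def by measurable
  define H where "H = (\<lambda>x. \<integral>\<^sup>+z. ennreal (g z * v z powr (- (1 / p))) * indicator {z. t z \<le> t x} z \<partial>M)"
  have [measurable]: "H \<in> borel_measurable M" unfolding H_def by measurable
  have step1: "ennreal_powr (F x) p \<le> ennreal ((p' * u x powr (1 / p')) powr (p - 1)) *
      (\<integral>\<^sup>+z. ennreal (g z * u z powr (1 / p')) * indicator {z. t z \<le> t x} z \<partial>M)"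
    if "W (t x) < \<infinity>" for x
  proof -
    \<comment> \<open>The factors are chosen so that almost everywhere on the sublevel set
      \<open>m * b = f\<close> and \<open>m * b powr p = g * u powr (1 / p')\<close>, while the
      total mass of \<open>m\<close> is the integral of a negative power of a distribution
      function.\<close>
    define m where "m = (\<lambda>z. ennreal (\<psi> z powr (- (p' - 1))) * ennreal (u z powr (- (1 / p))) *
      indicator {z. t z \<le> t x} z)"
    define b where "b = (\<lambda>z. f z * \<psi> z powr (p' - 1) * u z powr (1 / p))"
    have [measurable]: "m \<in> borel_measurable M" "b \<in> borel_measurable M"
      unfolding m_def b_def by measurable
    have "(\<integral>\<^sup>+z. m z \<partial>M) \<le> ennreal (u x powr (1 - 1 / p) / (1 - 1 / p))"
      unfolding m_def u_def W_def
      by (rule nn_integral_distribution_powr_neg_le) (use sf pq that in \<open>auto simp: W_def\<close>)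
    then have "(\<integral>\<^sup>+z. m z \<partial>M) \<le> ennreal (p' * u x powr (1 / p'))"
      by (simp add: conj mult.commute)
    then have "ennreal_powr (\<integral>\<^sup>+z. m z * ennreal (b z) \<partial>M) p
      \<le> ennreal ((p' * u x powr (1 / p')) powr (p - 1)) * (\<integral>\<^sup>+z. m z * ennreal (b z powr p) \<partial>M)"
      using pq p' by (intro nn_integral_jensen_powr) (auto simp: b_def f_nonneg)
    also have "(\<integral>\<^sup>+z. m z * ennreal (b z) \<partial>M) = F x"
      unfolding F_def
    proof (intro nn_integral_cong_AE, use good in eventually_elim)
      fix z assume "0 < u z \<and> 0 < v z \<and> W (t z) < \<infinity> \<and> V (t z) < \<infinity> \<and>
        u z powr (1 / p') \<le> a * v z powr (- (1 / q))"
      then have uz: "0 < u z" by simp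
      have "\<psi> z powr (- (p' - 1)) * \<psi> z powr (p' - 1) = 1"
        using \<psi>_pos[of z] by (simp flip: powr_add)
      moreover have "u z powr (- (1 / p)) * u z powr (1 / p) = 1" using uz by (simp flip: powr_add)
      moreover have "\<psi> z powr (- (p' - 1)) * u z powr (- (1 / p)) * b z
        = f z * (\<psi> z powr (- (p' - 1)) * \<psi> z powr (p' - 1)) * (u z powr (- (1 / p)) * u z powr (1 / p))"
        unfolding b_def by (simp only: mult_ac)
      ultimately have "\<psi> z powr (- (p' - 1)) * u z powr (- (1 / p)) * b z = f z" by simp
      then show "m z * ennreal (b z) = ennreal (f z) * indicator {z. t z \<le> t x} z"
        by (auto simp: m_def indicator_def simp flip: ennreal_mult' ennreal_mult'')
    qed
    also have "(\<integral>\<^sup>+z. m z * ennreal (b z powr p) \<partial>M)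
        = (\<integral>\<^sup>+z. ennreal (g z * u z powr (1 / p')) * indicator {z. t z \<le> t x} z \<partial>M)"
    proof (intro nn_integral_cong_AE, use good in eventually_elim)
      fix z assume "0 < u z \<and> 0 < v z \<and> W (t z) < \<infinity> \<and> V (t z) < \<infinity> \<and>
        u z powr (1 / p') \<le> a * v z powr (- (1 / q))"
      then have uz: "0 < u z" by simp
      have "\<psi> z powr (- (p' - 1)) * (\<psi> z powr (p' - 1)) powr p = \<psi> z"
      proof -
        have "- (p' - 1) + (p' - 1) * p = 1" using conj'(2) by simp
        then show ?thesis using \<psi>_pos[of z] by (simp add: powr_powr flip: powr_add)
      qed
      moreover have "u z powr (- (1 / p)) * (u z powr (1 / p)) powr p = u z powr (1 / p')"
      proof -
        have "- (1 / p) + 1 = 1 / p'" using conj by simp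
        then show ?thesis using uz p
          by (metis (no_types, opaque_lifting) nonzero_eq_divide_eq order_less_irrefl powr_add powr_powr)
      qed
      moreover have "b z powr p = f z powr p * (\<psi> z powr (p' - 1)) powr p * (u z powr (1 / p)) powr p"
        by (simp add: b_def powr_mult f_nonneg)
      ultimately have "\<psi> z powr (- (p' - 1)) * u z powr (- (1 / p)) * b z powr p = g z * u z powr (1 / p')"
        by (simp add: g_def mult_ac)
      then show "m z * ennreal (b z powr p)
          = ennreal (g z * u z powr (1 / p')) * indicator {z. t z \<le> t x} z"
        by (auto simp: m_def indicator_def simp flip: ennreal_mult' ennreal_mult'')
    qed
    finally show ?thesis .
  qed
  have step2: "ennreal_powr (\<integral>\<^sup>+z. ennreal (g z * u z powr (1 / p')) * indicator {z. t z \<le> t x} z \<partial>M) s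
    \<le> ennreal (i powr (s - 1) * a powr s) * H x" for x
  proof -
    \<comment> \<open>Now \<open>f powr p * \<psi>\<close> itself is the weight, with total mass at
      most \<open>i\<close>. Since \<open>s = q / p\<close>, the power \<open>s\<close> of
      \<open>v powr (- (1 / q))\<close> is \<open>v powr (- (1 / p))\<close>, the factor in
      \<open>H\<close>.\<close>
    define m where "m = (\<lambda>z. ennreal (g z) * indicator {z. t z \<le> t x} z)"
    have [measurable]: "m \<in> borel_measurable M" unfolding m_def by measurable
    have "(\<integral>\<^sup>+z. ennreal (g z * u z powr (1 / p')) * indicator {z. t z \<le> t x} z \<partial>M)
      \<le> (\<integral>\<^sup>+z. m z * ennreal (a * v z powr (- (1 / q))) \<partial>M)"
    proof (intro nn_integral_mono_AE, use good in eventually_elim)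
      fix z assume "0 < u z \<and> 0 < v z \<and> W (t z) < \<infinity> \<and> V (t z) < \<infinity> \<and>
        u z powr (1 / p') \<le> a * v z powr (- (1 / q))"
      then have "g z * u z powr (1 / p') \<le> g z * (a * v z powr (- (1 / q)))"
        using g by (intro mult_left_mono) auto
      then show "ennreal (g z * u z powr (1 / p')) * indicator {z. t z \<le> t x} z
          \<le> m z * ennreal (a * v z powr (- (1 / q)))"
        using g[of z] by (auto simp: m_def indicator_def ennreal_leI simp flip: ennreal_mult')
    qed
    then have "ennreal_powr (\<integral>\<^sup>+z. ennreal (g z * u z powr (1 / p')) * indicator {z. t z \<le> t x} z \<partial>M) s
      \<le> ennreal_powr (\<integral>\<^sup>+z. m z * ennreal (a * v z powr (- (1 / q))) \<partial>M) s"
      using s1 by (intro ennreal_powr_mono) auto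
    also have "\<dots> \<le> ennreal (i powr (s - 1)) * (\<integral>\<^sup>+z. m z * ennreal ((a * v z powr (- (1 / q))) powr s) \<partial>M)"
    proof (rule nn_integral_jensen_powr)
      have "(\<integral>\<^sup>+z. m z \<partial>M) \<le> ?I"
        by (intro nn_integral_mono) (auto simp: m_def g_def indicator_def)
      then show "(\<integral>\<^sup>+z. m z \<partial>M) \<le> ennreal i" by (simp add: I)
    qed (use a s1 i in auto)
    also have "(\<integral>\<^sup>+z. m z * ennreal ((a * v z powr (- (1 / q))) powr s) \<partial>M) = ennreal (a powr s) * H x"
      unfolding H_def
    proof (subst nn_integral_cmult[symmetric], measurable, intro nn_integral_cong)
      fix z
      have "- (1 / q) * s = - (1 / p)" using q by (simp add: s_def)
      then have "(a * v z powr (- (1 / q))) powr s = a powr s * v z powr (- (1 / p))"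
        using a by (simp add: powr_mult powr_powr)
      then show "m z * ennreal ((a * v z powr (- (1 / q))) powr s)
        = ennreal (a powr s) * (ennreal (g z * v z powr (- (1 / p))) * indicator {z. t z \<le> t x} z)"
        using g[of z] by (auto simp: m_def indicator_def mult_ac simp flip: ennreal_mult')
    qed
    finally show ?thesis by (simp add: ennreal_mult mult.assoc)
  qed
  define c where "c = p' powr (q / p') * a powr q * i powr (s - 1)"
  \<comment> \<open>The \<open>q\<close>-th power of \<open>F\<close> is the \<open>s\<close>-th
    power of its \<open>p\<close>-th power. The bound on \<open>u\<close> from \<open>good\<close>
    is used a second time, on the outer factor: the exponent \<open>(p - 1) * s = q / p'\<close>
    yields \<open>v x powr (- (1 / p'))\<close>, and the powers of \<open>a\<close> add up to
    \<open>q / p' + s = q\<close>.\<close>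
  have step3: "AE x in M. ennreal_powr (F x) q * ennreal (\<phi> x)
      \<le> ennreal c * (ennreal (\<phi> x) * ennreal (v x powr (- (1 / p'))) * H x)"
    using good
  proof eventually_elim
    fix x assume x: "0 < u x \<and> 0 < v x \<and> W (t x) < \<infinity> \<and> V (t x) < \<infinity> \<and>
        u x powr (1 / p') \<le> a * v x powr (- (1 / q))"
    let ?G = "\<integral>\<^sup>+z. ennreal (g z * u z powr (1 / p')) * indicator {z. t z \<le> t x} z \<partial>M"
    have "(p - 1) * s = (p - 1) / p * q" by (simp add: s_def)
    also have "\<dots> = q / p'" by (simp only: conj'(1)) simp
    finally have ps: "p * s = q" "(p - 1) * s = q / p'" using p by (simp_all add: s_def)
    have "((p' * u x powr (1 / p')) powr (p - 1)) powr s = (p' * u x powr (1 / p')) powr (q / p')"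
      by (simp add: powr_powr ps)
    also have "\<dots> \<le> (p' * (a * v x powr (- (1 / q)))) powr (q / p')"
      using x p' q by (intro powr_mono2 mult_left_mono) auto
    also have "\<dots> = p' powr (q / p') * a powr (q / p') * v x powr (- (1 / p'))"
    proof -
      have "- (1 / q) * (q / p') = - (1 / p')" using q by simp
      then show ?thesis using a p' by (simp add: powr_mult powr_powr)
    qed
    finally have le: "((p' * u x powr (1 / p')) powr (p - 1)) powr s \<le> \<dots>" .
    have "ennreal_powr (F x) q = ennreal_powr (ennreal_powr (F x) p) s"
      by (simp add: ennreal_powr_powr ps)
    also have "\<dots> \<le> ennreal_powr (ennreal ((p' * u x powr (1 / p')) powr (p - 1)) * ?G) s"
      using x s1 by (intro ennreal_powr_mono step1) auto
    also have "\<dots> = ennreal (((p' * u x powr (1 / p')) powr (p - 1)) powr s) * ennreal_powr ?G s"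
      using s1 by (simp add: ennreal_powr_mult ennreal_powr_ennreal)
    also have "\<dots> \<le> ennreal (p' powr (q / p') * a powr (q / p') * v x powr (- (1 / p'))) *
        (ennreal (i powr (s - 1) * a powr s) * H x)"
      by (intro mult_mono ennreal_leI le step2) auto
    also have "\<dots> = ennreal (c * v x powr (- (1 / p'))) * H x"
    proof -
      have "q / p' + s = q"
        using pq(3) p by (simp add: s_def) (metis (no_types, opaque_lifting) add.commute distrib_left mult.right_neutral times_divide_eq_right)
      then have "a powr (q / p') * a powr s = a powr q" by (simp flip: powr_add)
      then have "c * v x powr (- (1 / p')) = (p' powr (q / p') * a powr (q / p') * v x powr (- (1 / p'))) *
          (i powr (s - 1) * a powr s)" (is "_ = ?X * ?Y")
        unfolding c_def by (simp only: mult_ac flip: \<open>a powr (q / p') * a powr s = a powr q\<close>)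
      moreover have "ennreal (?X * ?Y) = ennreal ?X * ennreal ?Y" by (rule ennreal_mult) auto
      ultimately show ?thesis by (simp only: mult.assoc)
    qed
    finally have "ennreal_powr (F x) q \<le> ennreal (c * v x powr (- (1 / p'))) * H x" .
    then have "ennreal_powr (F x) q * ennreal (\<phi> x) \<le> ennreal (c * v x powr (- (1 / p'))) * H x * ennreal (\<phi> x)"
      by (intro mult_right_mono) auto
    also have "\<dots> = ennreal c * (ennreal (\<phi> x) * ennreal (v x powr (- (1 / p'))) * H x)"
      by (simp add: c_def ennreal_mult mult_ac)
    finally show "ennreal_powr (F x) q * ennreal (\<phi> x) \<le> \<dots>" .
  qed
  have "?L \<le> (\<integral>\<^sup>+x. ennreal c * (ennreal (\<phi> x) * ennreal (v x powr (- (1 / p'))) * H x) \<partial>M)"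
    using step3 unfolding F_def by (rule nn_integral_mono_AE)
  also have "\<dots> = ennreal c * (\<integral>\<^sup>+x. ennreal (\<phi> x) * ennreal (v x powr (- (1 / p'))) * H x \<partial>M)"
    by (rule nn_integral_cmult) measurable
  also have "(\<integral>\<^sup>+x. ennreal (\<phi> x) * ennreal (v x powr (- (1 / p'))) * H x \<partial>M)
    = (\<integral>\<^sup>+x. (\<integral>\<^sup>+z. ennreal (\<phi> x) * ennreal (v x powr (- (1 / p'))) *
        (ennreal (g z * v z powr (- (1 / p))) * indicator {z. t z \<le> t x} z) \<partial>M) \<partial>M)"
    unfolding H_def by (intro nn_integral_cong nn_integral_cmult[symmetric]) measurable
  \<comment> \<open>Exchanging the integrals turns the sublevel set in \<open>z\<close> into the
    superlevel set \<open>{x. t z \<le> t x}\<close>, over which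
    \<open>\<phi> * v powr (- (1 / p'))\<close> can be integrated.\<close>
  also have "\<dots> = (\<integral>\<^sup>+z. (\<integral>\<^sup>+x. ennreal (\<phi> x) * ennreal (v x powr (- (1 / p'))) *
        (ennreal (g z * v z powr (- (1 / p))) * indicator {z. t z \<le> t x} z) \<partial>M) \<partial>M)"
    by (rule Fubini') measurable
  also have "\<dots> = (\<integral>\<^sup>+z. ennreal (g z * v z powr (- (1 / p))) *
      (\<integral>\<^sup>+x. ennreal (\<phi> x) * ennreal (v x powr (- (1 / p'))) * indicator {x. t z \<le> t x} x \<partial>M) \<partial>M)"
    by (intro nn_integral_cong, subst nn_integral_cmult[symmetric])
      (auto simp: mult_ac indicator_def intro!: nn_integral_cong)
  \<comment> \<open>Replacing \<open>t\<close> by \<open>- t\<close> makes \<open>V\<close> a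
    sublevel integral, so the same power bound applies with exponent \<open>1 / p'\<close>. It gives
    \<open>p * v z powr (1 / p)\<close>, which cancels the negative power of
    \<open>v z\<close>.\<close>
  also have "\<dots> \<le> (\<integral>\<^sup>+z. ennreal p * ennreal (g z) \<partial>M)"
  proof (intro nn_integral_mono_AE, use good in eventually_elim)
    fix z assume z: "0 < u z \<and> 0 < v z \<and> W (t z) < \<infinity> \<and> V (t z) < \<infinity> \<and>
        u z powr (1 / p') \<le> a * v z powr (- (1 / q))"
    have "(\<integral>\<^sup>+x. ennreal (\<phi> x) * ennreal (v x powr (- (1 / p'))) * indicator {x. t z \<le> t x} x \<partial>M)
      \<le> ennreal (v z powr (1 - 1 / p') / (1 - 1 / p'))"
      using nn_integral_distribution_powr_neg_le[OF sf, of "\<lambda>x. - t x" "\<lambda>x. ennreal (\<phi> x)" "1 / p'" "- t z"]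
        p' z by (simp add: v_def V_def)
    then have "ennreal (g z * v z powr (- (1 / p))) *
      (\<integral>\<^sup>+x. ennreal (\<phi> x) * ennreal (v x powr (- (1 / p'))) * indicator {x. t z \<le> t x} x \<partial>M)
      \<le> ennreal (g z * v z powr (- (1 / p))) * ennreal (p * v z powr (1 / p))"
      by (intro mult_left_mono) (auto simp: conj mult.commute)
    also have "\<dots> = ennreal p * ennreal (g z)"
      using g[of z] p z by (simp add: powr_minus field_simps flip: ennreal_mult)
    finally show "ennreal (g z * v z powr (- (1 / p))) *
      (\<integral>\<^sup>+x. ennreal (\<phi> x) * ennreal (v x powr (- (1 / p'))) * indicator {x. t z \<le> t x} x \<partial>M) \<le> \<dots>" .
  qed
  also have "\<dots> = ennreal (p * i)"
    using p I by (simp add: nn_integral_cmult g_def ennreal_mult' flip: i_def)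
  also have "ennreal c * ennreal (p * i) = ennreal ?c * ennreal_powr ?I (q / p)"
  proof -
    have "i powr (s - 1) * i = i powr s"
      using i powr_mult_base[of i "s - 1"] by (simp add: mult.commute)
    then have "c * (p * i) = ?c * i powr s" by (simp add: c_def mult_ac)
    then show ?thesis
      using i p by (simp add: I ennreal_powr_ennreal c_def flip: ennreal_mult s_def)
  qed
  finally show ?thesis by (simp add: mult_left_mono)
qed

section \<open>Lebesgue measure: necessity, the smallest constant and the characterisation\<close>

lemma sigma_finite_lebesgue: "sigma_finite_measure (lebesgue :: 'a::euclidean_space measure)"
proof
  show "\<exists>A. countable A \<and> A \<subseteq> sets lebesgue \<and> \<Union> A = space (lebesgue :: 'a measure)
      \<and> (\<forall>a\<in>A. emeasure lebesgue a \<noteq> \<infinity>)"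
  proof (intro exI[of _ "range (\<lambda>n. cball (0::'a) (real n))"] conjI ballI)
    show "\<Union> (range (\<lambda>n. cball (0::'a) (real n))) = space lebesgue"
      by (auto intro: real_arch_simple)
    show "emeasure lebesgue a \<noteq> \<infinity>" if "a \<in> range (\<lambda>n. cball (0::'a) (real n))" for a
      using that fmeasurableD2[OF lmeasurable_cball[of "0::'a"]] by auto
  qed auto
qed

text \<open>The function \<open>w = \<psi> powr (- (p' - 1))\<close> satisfies
  \<open>w powr p * \<psi> = w\<close>, so for its truncations both sides involve the same integral.
  Dividing by the power \<open>1 / p\<close> of that integral leaves the claim.\<close>

lemma hardy_inequality_imp_le:
  fixes U :: "'a::euclidean_space \<Rightarrow> 'a set" and t \<phi> \<psi> :: "'a \<Rightarrow> real"
  assumes hardy: "hardy_inequality U \<phi> \<psi> p q C"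
    and t [measurable]: "t \<in> borel_measurable lebesgue"
    and \<phi> [measurable]: "\<phi> \<in> borel_measurable lebesgue"
    and \<psi> [measurable]: "\<psi> \<in> borel_measurable lebesgue" and \<psi>_pos: "\<And>x. 0 < \<psi> x"
    and pq: "1 < p" "p \<le> q" "1 / p + 1 / p' = 1"
    and U: "\<And>x. AE z in lebesgue. z \<in> U x \<longleftrightarrow> t z \<le> t x"
  shows "ennreal_powr (\<integral>\<^sup>+x\<in>{x. r \<le> t x}. ennreal (\<phi> x) \<partial>lebesgue) (1 / q) *
    ennreal_powr (\<integral>\<^sup>+x\<in>{x. t x \<le> r}. ennreal (\<psi> x powr (- (p' - 1))) \<partial>lebesgue) (1 / p') \<le> ennreal C"
    (is "ennreal_powr ?V _ * ennreal_powr ?W _ \<le> _")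
proof -
  note p'_eq = conjugate_exponent(1)[OF pq(1,3)] and p' = conjugate_exponent(2)[OF pq(1,3)]
  have q: "0 < q" using pq by simp
  define w where "w = (\<lambda>x. \<psi> x powr (- (p' - 1)))"
  have [measurable]: "w \<in> borel_measurable lebesgue" unfolding w_def by measurable
  have w: "0 \<le> w x" for x by (simp add: w_def)
  have w_powr: "w x powr p * \<psi> x = w x" for x
  proof -
    have "- (p' - 1) * p + 1 = - (p' - 1)" using pq by (simp add: p'_eq field_simps)
    moreover have "\<psi> x powr (- (p' - 1) * p) * \<psi> x = \<psi> x powr (- (p' - 1) * p + 1)"
      using \<psi>_pos[of x] by (simp add: powr_add)
    ultimately show ?thesis by (simp add: w_def powr_powr)
  qed
  \<comment> \<open>Bounding both \<open>w\<close> and the norm makes \<open>K n\<close> finite, as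
    the later cancellation requires. These sets exhaust the sublevel set as \<open>n\<close>
    grows.\<close>
  define E where "E = (\<lambda>n::nat. {z. t z \<le> r \<and> w z \<le> real n} \<inter> cball 0 (real n))"
  have E [measurable]: "E n \<in> sets lebesgue" for n
  proof -
    have "{z \<in> space lebesgue. t z \<le> r \<and> w z \<le> real n} \<in> sets lebesgue" by measurable
    then show ?thesis by (auto simp: E_def)
  qed
  define f where "f = (\<lambda>n z. w z * indicator (E n) z)"
  have f [measurable]: "f n \<in> borel_measurable lebesgue" for n unfolding f_def by measurable
  have f_nonneg: "0 \<le> f n z" for n z by (simp add: f_def w)
  define K where "K = (\<lambda>n. \<integral>\<^sup>+z. ennreal (f n z) \<partial>lebesgue)"
  have K_fin: "K n < \<infinity>" for n
  proof -
    have "K n \<le> (\<integral>\<^sup>+z. ennreal (real n) * indicator (cball (0::'a) (real n)) z \<partial>lebesgue)"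
      unfolding K_def by (intro nn_integral_mono) (auto simp: f_def E_def indicator_def intro!: ennreal_leI)
    also have "\<dots> = ennreal (real n) * emeasure lebesgue (cball (0::'a) (real n))"
      by (rule nn_integral_cmult_indicator) simp
    also have "\<dots> < \<infinity>"
      using fmeasurableD2[OF lmeasurable_cball[of "0::'a" "real n"]] by (auto simp: ennreal_mult_less_top less_top)
    finally show ?thesis .
  qed
  have *: "ennreal_powr ?V (1 / q) * ennreal_powr (K n) (1 / p') \<le> ennreal C" for n
  proof (cases "K n = 0")
    case True
    then show ?thesis using ennreal_powr_eq_0_iff[of 0 "1 / p'"] by simp
  next
    case False
    have "(\<integral>\<^sup>+x. ennreal (f n x powr p * \<psi> x) \<partial>lebesgue) = K n"
      unfolding K_def
    proof (intro nn_integral_cong)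
      fix x
      have "f n x powr p * \<psi> x = f n x" using w_powr[of x] pq by (simp add: f_def indicator_def)
      then show "ennreal (f n x powr p * \<psi> x) = ennreal (f n x)" by simp
    qed
    then have "ennreal_powr
          (\<integral>\<^sup>+x. ennreal_powr (\<integral>\<^sup>+z\<in>U x. ennreal (f n z) \<partial>lebesgue) q * ennreal (\<phi> x) \<partial>lebesgue) (1 / q)
        \<le> ennreal C * ennreal_powr (K n) (1 / p)"
      using hardy f[of n] f_nonneg[of n] unfolding hardy_inequality_def by fastforce
    \<comment> \<open>For \<open>r \<le> t x\<close> the support of \<open>f n\<close> lies in
      \<open>U x\<close> up to a null set, so the inner integral is the full \<open>K n\<close>. All
      other \<open>x\<close> are discarded.\<close>
    moreover have "ennreal_powr (\<integral>\<^sup>+x. ennreal_powr (K n) q * (ennreal (\<phi> x) * indicator {x. r \<le> t x} x) \<partial>lebesgue) (1 / q)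
      \<le> ennreal_powr
          (\<integral>\<^sup>+x. ennreal_powr (\<integral>\<^sup>+z\<in>U x. ennreal (f n z) \<partial>lebesgue) q * ennreal (\<phi> x) \<partial>lebesgue) (1 / q)"
    proof (intro ennreal_powr_mono nn_integral_mono)
      fix x
      have "(\<integral>\<^sup>+z\<in>U x. ennreal (f n z) \<partial>lebesgue) = K n" if "r \<le> t x"
        unfolding K_def
      proof (intro nn_integral_cong_AE, use U[of x] in eventually_elim)
        fix z assume "z \<in> U x \<longleftrightarrow> t z \<le> t x"
        then show "ennreal (f n z) * indicator (U x) z = ennreal (f n z)"
          using that by (auto simp: f_def E_def indicator_def)
      qed
      then show "ennreal_powr (K n) q * (ennreal (\<phi> x) * indicator {x. r \<le> t x} x)
        \<le> ennreal_powr (\<integral>\<^sup>+z\<in>U x. ennreal (f n z) \<partial>lebesgue) q * ennreal (\<phi> x)"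
        by (simp add: indicator_def)
    qed (use q in simp)
    ultimately have "ennreal_powr (\<integral>\<^sup>+x. ennreal_powr (K n) q * (ennreal (\<phi> x) * indicator {x. r \<le> t x} x) \<partial>lebesgue) (1 / q)
        \<le> ennreal C * ennreal_powr (K n) (1 / p)"
      by (rule order_trans[rotated])
    also have "(\<integral>\<^sup>+x. ennreal_powr (K n) q * (ennreal (\<phi> x) * indicator {x. r \<le> t x} x) \<partial>lebesgue)
      = ennreal_powr (K n) q * ?V"
      by (rule nn_integral_cmult) measurable
    also have "ennreal_powr (ennreal_powr (K n) q * ?V) (1 / q) = K n * ennreal_powr ?V (1 / q)"
      using q by (simp add: ennreal_powr_mult ennreal_powr_powr)
    finally have "K n * ennreal_powr ?V (1 / q) \<le> ennreal C * ennreal_powr (K n) (1 / p)" .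
    moreover have "K n = ennreal_powr (K n) (1 / p) * ennreal_powr (K n) (1 / p')"
    proof -
      obtain k where k: "K n = ennreal k" "0 < k" using False K_fin[of n]
        by (cases "K n") (auto simp: zero_less_iff_neq_zero less_le)
      have "k powr (1 / p) * k powr (1 / p') = k" using pq k by (simp flip: powr_add)
      then show ?thesis using k by (simp add: ennreal_powr_ennreal flip: ennreal_mult)
    qed
    ultimately have "ennreal_powr (K n) (1 / p) * (ennreal_powr ?V (1 / q) * ennreal_powr (K n) (1 / p'))
      \<le> ennreal_powr (K n) (1 / p) * ennreal C"
      by (metis mult.assoc mult.commute)
    moreover have "ennreal_powr (K n) (1 / p) \<noteq> 0" "ennreal_powr (K n) (1 / p) \<noteq> \<infinity>"
      using False K_fin[of n] ennreal_powr_less_top_iff[of "K n" "1 / p"] by (auto simp: ennreal_powr_eq_0_iff)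
    ultimately show ?thesis by (simp add: ennreal_mult_le_mult_iff)
  qed
  have "?W = (\<integral>\<^sup>+z. (SUP n. ennreal (f n z)) \<partial>lebesgue)"
  proof (intro nn_integral_cong antisym)
    fix z
    obtain n where n: "max (w z) (norm z) \<le> real n" using real_arch_simple by blast
    then have "ennreal (\<psi> z powr (- (p' - 1))) * indicator {x. t x \<le> r} z = ennreal (f n z)"
      by (auto simp: f_def E_def indicator_def w_def)
    also have "\<dots> \<le> (SUP n. ennreal (f n z))" by (rule SUP_upper) simp
    finally show "ennreal (\<psi> z powr (- (p' - 1))) * indicator {x. t x \<le> r} z \<le> \<dots>" .
    show "(SUP n. ennreal (f n z)) \<le> ennreal (\<psi> z powr (- (p' - 1))) * indicator {x. t x \<le> r} z"
      by (intro SUP_least) (auto simp: f_def E_def indicator_def w_def)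
  qed
  also have "\<dots> = (SUP n. K n)"
    unfolding K_def
  proof (rule nn_integral_monotone_convergence_SUP)
    show "incseq (\<lambda>n z. ennreal (f n z))"
      using w by (auto simp: incseq_def le_fun_def f_def E_def indicator_def intro!: ennreal_leI)
  qed measurable
  finally have "?W = (SUP n. K n)" .
  then have "ennreal_powr ?V (1 / q) * ennreal_powr ?W (1 / p')
    = (SUP n. ennreal_powr ?V (1 / q) * ennreal_powr (K n) (1 / p'))"
    using p' by (simp add: ennreal_powr_SUP SUP_mult_left_ennreal)
  also have "\<dots> \<le> ennreal C" by (intro SUP_least *)
  finally show ?thesis .
qed

text \<open>For fixed \<open>f\<close> the inequality passes to the infimum of the admissible
  constants. The positive lower bound handles an infinite integral on the right: there a constant
  \<open>0\<close> would make the right side \<open>0\<close> instead of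
  \<open>\<infinity>\<close>.\<close>

lemma smallest_hardy_constant_exists:
  assumes ex: "hardy_inequality U \<phi> \<psi> p q C\<^sub>0"
    and pos: "0 < a" and lower: "\<And>C. hardy_inequality U \<phi> \<psi> p q C \<Longrightarrow> a \<le> C"
  shows "\<exists>C. smallest_hardy_constant U \<phi> \<psi> p q C"
proof -
  define S where "S = {C. hardy_inequality U \<phi> \<psi> p q C}"
  have S: "S \<noteq> {}" "bdd_below S" using ex lower by (auto simp: S_def bdd_below_def)
  have "a \<le> Inf S" using S(1) lower by (intro cInf_greatest) (auto simp: S_def)
  with pos have Inf: "0 < Inf S" by simp
  have "hardy_inequality U \<phi> \<psi> p q (Inf S)"
    unfolding hardy_inequality_def
  proof (intro conjI allI impI)
    fix f :: "'a \<Rightarrow> real"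
    assume f: "f \<in> borel_measurable lebesgue" "AE x in lebesgue. 0 \<le> f x"
    define L where "L = ennreal_powr
      (\<integral>\<^sup>+x. ennreal_powr (\<integral>\<^sup>+z\<in>U x. ennreal (f z) \<partial>lebesgue) q * ennreal (\<phi> x) \<partial>lebesgue) (1 / q)"
    define R where "R = ennreal_powr (\<integral>\<^sup>+x. ennreal (f x powr p * \<psi> x) \<partial>lebesgue) (1 / p)"
    have le: "L \<le> ennreal C * R" if "C \<in> S" for C
      using that f unfolding S_def hardy_inequality_def L_def R_def by blast
    obtain C\<^sub>1 where C\<^sub>1: "C\<^sub>1 \<in> S" using S by blast
    have "L \<le> ennreal (Inf S) * R"
    proof (cases R)
      case (real r)
      show ?thesis
      proof (cases "r = 0")
        case True
        then show ?thesis using le[OF C\<^sub>1] real by simp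
      next
        case False
        have "L < \<infinity>" using le[OF C\<^sub>1] real by (auto simp: ennreal_mult_less_top intro: le_less_trans)
        then obtain l where l: "L = ennreal l" "0 \<le> l" by (cases L) auto
        have "l / r \<le> C" if "C \<in> S" for C
        proof -
          have C: "0 \<le> C" using that by (simp add: S_def hardy_inequality_def)
          then have "l \<le> C * r" using le[OF that] real l by (simp flip: ennreal_mult)
          then show ?thesis using real False by (simp add: field_simps)
        qed
        then have "l / r \<le> Inf S" using S(1) by (intro cInf_greatest)
        then have "l \<le> Inf S * r" using real False by (simp add: field_simps)
        then show ?thesis using real l Inf by (simp flip: ennreal_mult)
      qed
    next
      case top
      then show ?thesis using Inf by (simp add: ennreal_mult_top)
    qed
    then show "ennreal_powr
        (\<integral>\<^sup>+x. ennreal_powr (\<integral>\<^sup>+z\<in>U x. ennreal (f z) \<partial>lebesgue) q * ennreal (\<phi> x) \<partial>lebesgue) (1 / q)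
      \<le> ennreal (Inf S) * ennreal_powr (\<integral>\<^sup>+x. ennreal (f x powr p * \<psi> x) \<partial>lebesgue) (1 / p)"
      by (simp add: L_def R_def)
  qed (use Inf in simp)
  then show ?thesis
    using cInf_lower[OF _ S(2)] unfolding smallest_hardy_constant_def by (auto simp: S_def)
qed

lemma nn_integral_pos_on_not_negligible:
  fixes g :: "'a::euclidean_space \<Rightarrow> real"
  assumes [measurable]: "g \<in> borel_measurable lebesgue" and g: "\<And>x. 0 < g x"
    and S [measurable]: "S \<in> sets lebesgue" and "\<not> negligible S"
  shows "(\<integral>\<^sup>+x\<in>S. ennreal (g x) \<partial>lebesgue) \<noteq> 0"
proof
  assume "(\<integral>\<^sup>+x\<in>S. ennreal (g x) \<partial>lebesgue) = 0"
  then have "AE x in lebesgue. ennreal (g x) * indicator S x = 0"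
    by (subst (asm) nn_integral_0_iff_AE) auto
  then have "AE x in lebesgue. x \<notin> S"
  proof eventually_elim
    fix x assume "ennreal (g x) * indicator S x = 0"
    then show "x \<notin> S" using g[of x] by (auto simp: indicator_def split: if_splits)
  qed
  then have "S \<in> null_sets lebesgue" by (simp add: AE_iff_null_sets[OF S])
  with \<open>\<not> negligible S\<close> show False by (simp add: negligible_iff_null_sets)
qed

text \<open>The map \<open>\<sigma>\<close> describes the levels of \<open>t\<close> by radii, so
  that \<open>t = N\<close> with \<open>\<sigma> R = R\<close> and \<open>t = - N\<close> with
  \<open>\<sigma> R = - R\<close> are both instances. The non-negligible sets keep \<open>V\<close>
  and \<open>W\<close> nonzero at every \<open>\<sigma> R\<close>.\<close>

lemma hardy_characterisation:
  fixes U :: "'a::euclidean_space \<Rightarrow> 'a set" and t \<phi> \<psi> :: "'a \<Rightarrow> real" and p p' q :: real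
  assumes t [measurable]: "t \<in> borel_measurable lebesgue"
    and \<phi> [measurable]: "\<phi> \<in> borel_measurable lebesgue" and \<phi>_pos: "\<And>x. 0 < \<phi> x"
    and \<psi> [measurable]: "\<psi> \<in> borel_measurable lebesgue" and \<psi>_pos: "\<And>x. 0 < \<psi> x"
    and pq: "1 < p" "p \<le> q" "1 / p + 1 / p' = 1"
    and U: "\<And>x. AE z in lebesgue. z \<in> U x \<longleftrightarrow> t z \<le> t x"
    and range: "AE x in lebesgue. \<exists>R>0. t x = \<sigma> R"
    and not_negligible: "\<And>R. 0 < R \<Longrightarrow> \<not> negligible {x. \<sigma> R \<le> t x}"
      "\<And>R. 0 < R \<Longrightarrow> \<not> negligible {x. t x \<le> \<sigma> R}"
  defines "A \<equiv> hardy_sup (\<lambda>R. {x. \<sigma> R \<le> t x}) (\<lambda>R. {x. t x \<le> \<sigma> R}) \<phi> \<psi> p' q"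
    and "k \<equiv> p' powr (1 / p') * p powr (1 / q)"
  shows "(\<exists>C. hardy_inequality U \<phi> \<psi> p q C) \<longleftrightarrow> A < \<infinity>"
    and "A < \<infinity> \<Longrightarrow> \<exists>C. smallest_hardy_constant U \<phi> \<psi> p q C"
    and "smallest_hardy_constant U \<phi> \<psi> p q C \<Longrightarrow> A \<le> ennreal C \<and> ennreal C \<le> ennreal k * A"
proof -
  note p' = conjugate_exponent(2)[OF pq(1,3)]
  have q: "0 < q" using pq by simp
  define V where "V = (\<lambda>r. \<integral>\<^sup>+x. ennreal (\<phi> x) * indicator {x. r \<le> t x} x \<partial>lebesgue)"
  define W where "W = (\<lambda>r. \<integral>\<^sup>+x. ennreal (\<psi> x powr (- (p' - 1))) * indicator {x. t x \<le> r} x \<partial>lebesgue)"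
  have A: "A = (SUP R\<in>{0<..}. ennreal_powr (V (\<sigma> R)) (1 / q) * ennreal_powr (W (\<sigma> R)) (1 / p'))"
    by (simp add: A_def hardy_sup_def V_def W_def)
  have lower: "A \<le> ennreal C" if "hardy_inequality U \<phi> \<psi> p q C" for C
    unfolding A V_def W_def
    by (intro SUP_least hardy_inequality_imp_le[OF that t \<phi> \<psi> \<psi>_pos pq U])
  have sets: "{x. r \<le> t x} \<in> sets lebesgue" "{x. t x \<le> r} \<in> sets lebesgue" for r
    using measurable_sets[OF t, of "{r..}"] measurable_sets[OF t, of "{..r}"]
    by (simp_all add: vimage_def)
  have nonzero: "V (\<sigma> R) \<noteq> 0" "W (\<sigma> R) \<noteq> 0" if "0 < R" for R
    unfolding V_def W_def
    using nn_integral_pos_on_not_negligible[of \<phi> "{x. \<sigma> R \<le> t x}"]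
      nn_integral_pos_on_not_negligible[of "\<lambda>x. \<psi> x powr (- (p' - 1))" "{x. t x \<le> \<sigma> R}"]
      \<phi>_pos less_imp_neq[OF \<psi>_pos] not_negligible[OF that] sets by auto
  \<comment> \<open>Positivity serves twice: as \<open>0 < a\<close> in the sufficiency and as the
    lower bound for the smallest constant.\<close>
  have A_pos: "0 < A"
  proof -
    have "0 < ennreal_powr (V (\<sigma> 1)) (1 / q) * ennreal_powr (W (\<sigma> 1)) (1 / p')"
      using nonzero[of 1] by (simp add: ennreal_powr_eq_0_iff zero_less_iff_neq_zero)
    also have "\<dots> \<le> A" unfolding A by (rule SUP_upper) simp
    finally show ?thesis .
  qed
  have upper: "hardy_inequality U \<phi> \<psi> p q (k * enn2real A)" if fin: "A < \<infinity>"
    unfolding hardy_inequality_def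
  proof (intro conjI allI impI)
    define a where "a = enn2real A"
    have a: "0 < a" "A = ennreal a" using A_pos fin by (auto simp: a_def enn2real_positive_iff)
    have VW: "ennreal_powr (V (\<sigma> R)) (1 / q) * ennreal_powr (W (\<sigma> R)) (1 / p') \<le> ennreal a" if "0 < R" for R
      unfolding a(2)[symmetric] A by (rule SUP_upper) (use that in simp)
    \<comment> \<open>A finite product bounds each factor because the other one is nonzero.\<close>
    have finite: "V (\<sigma> R) < \<infinity>" "W (\<sigma> R) < \<infinity>" if "0 < R" for R
    proof -
      have "ennreal_powr (V (\<sigma> R)) (1 / q) * ennreal_powr (W (\<sigma> R)) (1 / p') < \<infinity>"
        using VW[OF that] by (rule le_less_trans) simp
      then show "V (\<sigma> R) < \<infinity>" "W (\<sigma> R) < \<infinity>"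
        using nonzero[OF that] by (auto simp: ennreal_mult_less_top ennreal_powr_eq_0_iff ennreal_powr_less_top_iff)
    qed
    fix f :: "'a \<Rightarrow> real"
    assume f: "f \<in> borel_measurable lebesgue" "AE x in lebesgue. 0 \<le> f x"
    \<comment> \<open>\<open>f\<close> is nonnegative only almost everywhere, whereas the sublevel
      estimate asks for it everywhere.\<close>
    define g where "g = (\<lambda>x. max 0 (f x))"
    have g_measurable: "g \<in> borel_measurable lebesgue" using f(1) unfolding g_def by measurable
    let ?I = "\<integral>\<^sup>+x. ennreal (g x powr p * \<psi> x) \<partial>lebesgue"
    have I: "?I = (\<integral>\<^sup>+x. ennreal (f x powr p * \<psi> x) \<partial>lebesgue)"
      using f(2) by (intro nn_integral_cong_AE) (auto simp: g_def)
    have F: "(\<integral>\<^sup>+z\<in>U x. ennreal (f z) \<partial>lebesgue) = (\<integral>\<^sup>+z. ennreal (g z) * indicator {z. t z \<le> t x} z \<partial>lebesgue)" for x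
      using U[of x] by (intro nn_integral_cong_AE) (auto simp: g_def indicator_def max_def ennreal_neg)
    have "(\<integral>\<^sup>+x. ennreal_powr (\<integral>\<^sup>+z\<in>U x. ennreal (f z) \<partial>lebesgue) q * ennreal (\<phi> x) \<partial>lebesgue)
      \<le> ennreal (p' powr (q / p') * p * a powr q) * ennreal_powr ?I (q / p)"
      unfolding F
    proof (rule hardy_sublevel[OF sigma_finite_lebesgue t \<phi> \<phi>_pos \<psi> \<psi>_pos pq a(1) _ _ _ g_measurable])
      show "AE x in lebesgue. 0 < (\<integral>\<^sup>+y. ennreal (\<phi> y) * indicator {y. t x \<le> t y} y \<partial>lebesgue) \<and>
          (\<integral>\<^sup>+y. ennreal (\<phi> y) * indicator {y. t x \<le> t y} y \<partial>lebesgue) < \<infinity>"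
        using range nonzero finite unfolding V_def by (fastforce simp: zero_less_iff_neq_zero)
      show "AE x in lebesgue. 0 < (\<integral>\<^sup>+y. ennreal (\<psi> y powr (- (p' - 1))) * indicator {y. t y \<le> t x} y \<partial>lebesgue) \<and>
          (\<integral>\<^sup>+y. ennreal (\<psi> y powr (- (p' - 1))) * indicator {y. t y \<le> t x} y \<partial>lebesgue) < \<infinity>"
        using range nonzero finite unfolding W_def by (fastforce simp: zero_less_iff_neq_zero)
      show "AE x in lebesgue. ennreal_powr (\<integral>\<^sup>+y. ennreal (\<phi> y) * indicator {y. t x \<le> t y} y \<partial>lebesgue) (1 / q) *
          ennreal_powr (\<integral>\<^sup>+y. ennreal (\<psi> y powr (- (p' - 1))) * indicator {y. t y \<le> t x} y \<partial>lebesgue) (1 / p') \<le> ennreal a"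
        using range VW unfolding V_def W_def by fastforce
    qed (simp add: g_def)
    then have "ennreal_powr
        (\<integral>\<^sup>+x. ennreal_powr (\<integral>\<^sup>+z\<in>U x. ennreal (f z) \<partial>lebesgue) q * ennreal (\<phi> x) \<partial>lebesgue) (1 / q)
      \<le> ennreal_powr (ennreal (p' powr (q / p') * p * a powr q) * ennreal_powr ?I (q / p)) (1 / q)"
      using q by (intro ennreal_powr_mono) auto
    also have "\<dots> = ennreal ((p' powr (q / p') * p * a powr q) powr (1 / q)) * ennreal_powr ?I (1 / p)"
      using q pq by (simp add: ennreal_powr_mult ennreal_powr_powr ennreal_powr_ennreal)
    also have "(p' powr (q / p') * p * a powr q) powr (1 / q) = k * a"
      using q pq a p' by (simp add: k_def powr_mult powr_powr)
    finally show "ennreal_powr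
        (\<integral>\<^sup>+x. ennreal_powr (\<integral>\<^sup>+z\<in>U x. ennreal (f z) \<partial>lebesgue) q * ennreal (\<phi> x) \<partial>lebesgue) (1 / q)
      \<le> ennreal (k * enn2real A) * ennreal_powr (\<integral>\<^sup>+x. ennreal (f x powr p * \<psi> x) \<partial>lebesgue) (1 / p)"
      by (simp add: I a_def)
  qed (simp add: k_def)
  show "(\<exists>C. hardy_inequality U \<phi> \<psi> p q C) \<longleftrightarrow> A < \<infinity>"
    by (metis ennreal_less_top infinity_ennreal_def le_less_trans lower upper)
  show "\<exists>C. smallest_hardy_constant U \<phi> \<psi> p q C" if "A < \<infinity>"
  proof (rule smallest_hardy_constant_exists[OF upper[OF that]])
    show "0 < enn2real A" using A_pos that by (simp add: enn2real_positive_iff)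
    fix C assume C: "hardy_inequality U \<phi> \<psi> p q C"
    then have "0 \<le> C" by (simp add: hardy_inequality_def)
    then show "enn2real A \<le> C" using lower[OF C] by (rule enn2real_leI)
  qed
  show "A \<le> ennreal C \<and> ennreal C \<le> ennreal k * A" if C: "smallest_hardy_constant U \<phi> \<psi> p q C"
  proof
    show le: "A \<le> ennreal C" using C lower by (simp add: smallest_hardy_constant_def)
    then have fin: "A < \<infinity>" by (rule le_less_trans) simp
    then have "C \<le> k * enn2real A" using C upper by (simp add: smallest_hardy_constant_def)
    then have "ennreal C \<le> ennreal (k * enn2real A)" by (rule ennreal_leI)
    also have "\<dots> = ennreal k * A" using fin by (simp add: ennreal_mult k_def)
    finally show "ennreal C \<le> ennreal k * A" .
  qed
qed

subsection \<open>Level sets of a quasi-norm\<close>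

text \<open>A non-negligible level gives an atom of the image under \<open>N\<close> of Lebesgue
  measure on some ball, and a finite measure has only countably many atoms. Restricting to balls of
  integer radius makes these measures finite.\<close>

lemma countable_non_negligible_levels:
  fixes N :: "'a::euclidean_space \<Rightarrow> real"
  assumes "N \<in> borel_measurable borel"
  shows "countable {R. \<not> negligible {x. N x = R}}"
proof -
  define M where "M = (\<lambda>n. distr (restrict_space lborel (cball (0::'a) (real n))) borel N)"
  have N_meas: "N \<in> restrict_space lborel (cball (0::'a) (real n)) \<rightarrow>\<^sub>M borel" for n
    using assms by (intro measurable_restrict_space1) simp
  have fin: "finite_measure (M n)" for n
    unfolding M_def
  proof (rule finite_measure.finite_measure_distr[OF _ N_meas])
    show "finite_measure (restrict_space lborel (cball (0::'a) (real n)))"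
      using emeasure_lborel_cball_finite[of "0::'a" "real n"]
      by (intro finite_measureI) (simp add: space_restrict_space emeasure_restrict_space)
  qed
  have "{R. \<not> negligible {x. N x = R}} \<subseteq> (\<Union>n. {R. measure (M n) {R} \<noteq> 0})"
  proof (rule subsetI, rule ccontr)
    fix R assume R: "R \<in> {R. \<not> negligible {x. N x = R}}" "R \<notin> (\<Union>n. {R. measure (M n) {R} \<noteq> 0})"
    have "negligible ({x. N x = R} \<inter> cball 0 (real n))" for n
    proof -
      have set: "{x. N x = R} \<inter> cball 0 (real n) \<in> sets borel"
        using measurable_sets[OF assms, of "{R}"] by (auto simp: vimage_def)
      have "emeasure (M n) {R} = emeasure lborel ({x. N x = R} \<inter> cball 0 (real n))"
        unfolding M_def using N_meas[of n]
        by (subst emeasure_distr)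
          (auto simp: space_restrict_space emeasure_restrict_space vimage_def intro!: arg_cong2[where f=emeasure])
      moreover have "emeasure (M n) {R} = 0"
        using R finite_measure.emeasure_eq_measure[OF fin] by simp
      ultimately have "{x. N x = R} \<inter> cball 0 (real n) \<in> null_sets lborel"
        using set by (intro null_setsI) auto
      then show ?thesis by (simp add: negligible_iff_null_sets null_sets_completionI)
    qed
    then have "negligible (\<Union>n. {x. N x = R} \<inter> cball 0 (real n))" by (intro negligible_Union_nat) auto
    moreover have "(\<Union>n. {x. N x = R} \<inter> cball 0 (real n)) = {x. N x = R}"
      by (auto intro: real_arch_simple)
    ultimately show False using R by simp
  qed
  moreover have "countable (\<Union>n. {R. measure (M n) {R} \<noteq> 0})"
    using finite_measure.countable_support[OF fin] by blast
  ultimately show ?thesis by (rule countable_subset)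
qed

text \<open>Dilations carry the level sets to each other, so if one positive level set were not negligible
  then none would be, whereas only countably many can be.\<close>

lemma negligible_level_set:
  fixes N :: "'a::euclidean_space \<Rightarrow> real"
  assumes cont: "continuous_on UNIV N" and nonneg: "\<And>x. 0 \<le> N x" and zero: "\<And>x. N x = 0 \<longleftrightarrow> x = 0"
    and lin: "\<And>r. 0 < r \<Longrightarrow> linear (D r)" and hom: "\<And>r x. 0 < r \<Longrightarrow> N (D r x) = r * N x"
  shows "negligible {x. N x = R}"
proof (cases "0 < R")
  case False
  then have "{x. N x = R} \<subseteq> {0}" using nonneg zero by (auto simp: not_less) (metis antisym)
  then show ?thesis using negligible_sing negligible_subset by blast
next
  case R: True
  have "uncountable {0<..<1::real}" by (simp add: uncountable_open_interval)
  moreover have "countable {R. \<not> negligible {x. N x = R}}"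
    using cont by (intro countable_non_negligible_levels borel_measurable_continuous_onI)
  ultimately obtain r where r: "0 < r" "negligible {x. N x = r}"
    by (metis (no_types, lifting) countable_subset greaterThanLessThan_iff mem_Collect_eq subsetI)
  define c where "c = R / r"
  have c: "0 < c" using R r by (simp add: c_def)
  \<comment> \<open>The kernel is trivial because \<open>N\<close> vanishes only at
    \<open>0\<close>, and an injective linear map of a finite-dimensional space is onto. Hence the
    level \<open>R\<close> is contained in the linear image of the null level
    \<open>r\<close>.\<close>
  have "inj (D c)"
  proof (subst linear_injective_0[OF lin[OF c]], intro allI impI)
    fix x assume "D c x = 0"
    then have "c * N x = 0" using hom[OF c, of x] zero[of 0] by simp
    then show "x = 0" using c zero by simp
  qed
  then have "surj (D c)" by (rule linear_inj_imp_surj[OF lin[OF c]])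
  then have "{x. N x = R} \<subseteq> D c ` {x. N x = r}"
    using c r R by (auto simp: hom c_def image_iff surj_def) (metis c c_def hom nonzero_mult_div_cancel_left divide_eq_eq less_irrefl mult.commute)
  moreover have "negligible (D c ` {x. N x = r})"
    by (intro negligible_differentiable_image_negligible r order_refl
      differentiable_at_imp_differentiable_on linear_imp_differentiable lin[OF c])
  ultimately show ?thesis by (rule negligible_subset[rotated])
qed

section \<open>The two Hardy inequalities on a homogeneous group\<close>

theorem theorem3p1:
  fixes G :: "(real ^ 'n::finite) monoid"
    and A :: "real ^ 'n \<Rightarrow> real ^ 'n"
    and N :: "real ^ 'n \<Rightarrow> real"
    and \<phi>\<^sub>1 \<phi>\<^sub>2 \<psi>\<^sub>1 \<psi>\<^sub>2 :: "real ^ 'n \<Rightarrow> real"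
    and Q p p' q :: real
    and A\<^sub>1 A\<^sub>2 :: ennreal
    and U\<^sub>1 U\<^sub>2 :: "real ^ 'n \<Rightarrow> (real ^ 'n) set"
  assumes "homogeneous_group G A"
    and "Q = homogeneous_dimension A"
    and "homogeneous_quasi_norm G A N"
    and "\<phi>\<^sub>1 \<in> borel_measurable lebesgue" and "\<And>x. \<phi>\<^sub>1 x > 0"
    and "\<phi>\<^sub>2 \<in> borel_measurable lebesgue" and "\<And>x. \<phi>\<^sub>2 x > 0"
    and "\<psi>\<^sub>1 \<in> borel_measurable lebesgue" and "\<And>x. \<psi>\<^sub>1 x > 0"
    and "\<psi>\<^sub>2 \<in> borel_measurable lebesgue" and "\<And>x. \<psi>\<^sub>2 x > 0"
    and "1 < p" and "p \<le> q"
    and "1 / p + 1 / p' = 1"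
  defines "U\<^sub>1 \<equiv> \<lambda>x. quasi_ball G N 0 (N x)"
    and "U\<^sub>2 \<equiv> \<lambda>x. UNIV - quasi_ball G N 0 (N x)"
    and "A\<^sub>1 \<equiv> hardy_sup (\<lambda>R. {x. N x \<ge> R}) (\<lambda>R. {x. N x \<le> R}) \<phi>\<^sub>1 \<psi>\<^sub>1 p' q"
    and "A\<^sub>2 \<equiv> hardy_sup (\<lambda>R. {x. N x \<le> R}) (\<lambda>R. {x. N x \<ge> R}) \<phi>\<^sub>2 \<psi>\<^sub>2 p' q"
  shows
    "((\<exists>C. hardy_inequality U\<^sub>1 \<phi>\<^sub>1 \<psi>\<^sub>1 p q C) \<longleftrightarrow> A\<^sub>1 < \<infinity>) \<and>
     ((\<exists>C. hardy_inequality U\<^sub>2 \<phi>\<^sub>2 \<psi>\<^sub>2 p q C) \<longleftrightarrow> A\<^sub>2 < \<infinity>) \<and>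
     (A\<^sub>1 < \<infinity> \<longrightarrow> (\<exists>C. smallest_hardy_constant U\<^sub>1 \<phi>\<^sub>1 \<psi>\<^sub>1 p q C)) \<and>
     (A\<^sub>2 < \<infinity> \<longrightarrow> (\<exists>C. smallest_hardy_constant U\<^sub>2 \<phi>\<^sub>2 \<psi>\<^sub>2 p q C)) \<and>
     (\<forall>C\<^sub>1. smallest_hardy_constant U\<^sub>1 \<phi>\<^sub>1 \<psi>\<^sub>1 p q C\<^sub>1 \<longrightarrow>
        A\<^sub>1 \<le> ennreal C\<^sub>1 \<and> ennreal C\<^sub>1 \<le> ennreal (p' powr (1 / p') * p powr (1 / q)) * A\<^sub>1) \<and>
     (\<forall>C\<^sub>2. smallest_hardy_constant U\<^sub>2 \<phi>\<^sub>2 \<psi>\<^sub>2 p q C\<^sub>2 \<longrightarrow>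
        A\<^sub>2 \<le> ennreal C\<^sub>2 \<and> ennreal C\<^sub>2 \<le> ennreal (p' powr (1 / p') * p powr (1 / q)) * A\<^sub>2)"
proof -
  interpret homogeneous_group G A by fact
  have cont: "continuous_on UNIV N" and nonneg: "\<And>x. 0 \<le> N x" and zero: "\<And>x. N x = 0 \<longleftrightarrow> x = 0"
    and hom: "\<And>r x. 0 < r \<Longrightarrow> N (dilation A r x) = r * N x"
    using assms(3) by (auto simp: homogeneous_quasi_norm_def)
  have ball: "quasi_ball G N 0 r = {y. N y < r}" for r
  proof -
    have "inv\<^bsub>G\<^esub> 0 \<otimes>\<^bsub>G\<^esub> y = y" for y
      using inv_one l_one[of y] by (simp add: one_zero carrier_UNIV)
    then show ?thesis by (simp add: quasi_ball_def)
  qed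
  have "N \<in> borel_measurable borel" using cont by (rule borel_measurable_continuous_onI)
  then have N [measurable]: "N \<in> borel_measurable lebesgue" by (intro measurable_completion) simp
  have level: "AE z in lebesgue. N z \<noteq> r" for r
  proof -
    have "negligible {z. N z = r}"
      by (rule negligible_level_set[where D = "dilation A"]) (use cont nonneg zero linear_dilation hom in auto)
    then show ?thesis
      by (intro AE_I'[of "{z. N z = r}"]) (auto simp: negligible_iff_null_sets)
  qed
  have pos: "AE x in lebesgue. 0 < N x"
    using level[of 0] by eventually_elim (use nonneg in \<open>auto simp: less_le\<close>)
  have le: "\<not> negligible {x. N x \<le> r}" if "0 < r" for r
  proof
    assume "negligible {x. N x \<le> r}"
    then have "negligible {x. N x < r}" by (rule negligible_subset) auto
    moreover have "open {x. N x < r}" using cont by (intro open_Collect_less) auto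
    moreover have "0 \<in> {x. N x < r}" using zero[of 0] that by simp
    ultimately show False using open_not_negligible by blast
  qed
  have ge: "\<not> negligible {x. r \<le> N x}" if "0 < r" for r
  proof
    assume "negligible {x. r \<le> N x}"
    then have "negligible {x. r < N x}" by (rule negligible_subset) auto
    moreover have "open {x. r < N x}" using cont by (intro open_Collect_less) auto
    moreover
    \<comment> \<open>A nonzero point dilated to quasi-norm \<open>2 * r\<close> shows that the open
      set \<open>{x. r < N x}\<close> is nonempty.\<close>
    obtain x :: "real ^ 'n" where "x \<noteq> 0" using zero_neq_one by blast
    then have "0 < N x" using nonneg[of x] zero[of x] by simp
    then have "N (dilation A (2 * r / N x) x) = 2 * r" using that by (simp add: hom)
    then have "dilation A (2 * r / N x) x \<in> {x. r < N x}" using that by simp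
    ultimately show False using open_not_negligible by blast
  qed
  \<comment> \<open>The quasi-ball differs from the sublevel set of \<open>N\<close> by a null
    sphere. Its complement in \<open>U\<^sub>2\<close> is exactly \<open>{z. N x \<le> N z}\<close>,
    with no exceptional set.\<close>
  have U\<^sub>1: "AE z in lebesgue. z \<in> U\<^sub>1 x \<longleftrightarrow> N z \<le> N x" for x
    using level[of "N x"] by eventually_elim (auto simp: U\<^sub>1_def ball)
  have U\<^sub>2: "AE z in lebesgue. z \<in> U\<^sub>2 x \<longleftrightarrow> - N z \<le> - N x" for x
    by (auto simp: U\<^sub>2_def ball)
  have minus_N: "(\<lambda>x. - N x) \<in> borel_measurable lebesgue" by measurable
  have range: "AE x in lebesgue. \<exists>R>0. N x = R" "AE x in lebesgue. \<exists>R>0. - N x = - R"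
    using pos by auto
  note first = hardy_characterisation[where t = N and \<sigma> = "\<lambda>R. R",
      OF N assms(4,5,8,9,12-14) U\<^sub>1 range(1) ge le, folded A\<^sub>1_def]
  \<comment> \<open>For \<open>- N\<close> the superlevel sets are \<open>{x. N x \<le> R}\<close>,
    so \<open>le\<close> and \<open>ge\<close> are supplied in the opposite order.\<close>
  note second = hardy_characterisation[where t = "\<lambda>x. - N x" and \<sigma> = "\<lambda>R. - R",
      OF minus_N assms(6,7,10,11,12-14) U\<^sub>2 range(2), unfolded neg_le_iff_le, OF le ge, folded A\<^sub>2_def]
  show ?thesis
    by (intro conjI allI impI first second)
qed

end
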